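(* Let $n\ge4$, let $(p_{j,r})\in[0,1]^{[n]\times[n]}$ with $\lambda>0$, and let $S_n$ be the random diagonal sum of the associated Bernoulli matrix. Then $$d_{\mathrm{TV}}(P^{S_n},Q_2)\le\frac{1-e^{-\lambda}}{\lambda}\,\varepsilon,$$ where $$\varepsilon=\min\Bigl\{1,\sqrt{\tfrac{2}{\lambda e}}\Bigr\}(\varepsilon_1+\varepsilon_2)+\frac{1-e^{-\lambda}}{\lambda}\varepsilon_3,$$ $$\varepsilon_1=\frac2n\sum_{j=1}^n\sum_{r=1}^n\overline{p}_{j,\cdot}\,p_{j,r}\,|\lambda-\lambda'_{j,r}|,$$ $$\varepsilon_2=\frac{1}{n^2(n-1)}\sum_{(j,k)\in[n]^2_{\ne}}\sum_{(r,s)\in[n]^2_{\ne}}|p_{j,r}-p_{j,s}|\,|p_{k,r}-p_{k,s}|\,|\lambda-\lambda''_{j,k,r,s}|,$$ $$\varepsilon_3=\frac{2n^2}{(n-2)^2}\Bigl(\frac{n-2}{n-1}\sum_{j=1}^n\overline{p}_{j,\cdot}^2+\sqrt{\frac{n-1}{n-3}}\,\gamma''\Bigr)^2,$$ and, for $(j,k),(r,s)\in[n]^2_{\ne}$, $$\lambda'_{j,r}=\frac1{n-1}\sum_{u\in[n]\setminus\{j\}}\sum_{v\in[n]\setminus\{r\}}p_{u,v}=\frac{1}{n-1}\bigl(n(\lambda-\overline{p}_{j,\cdot}-\overline{p}_{\cdot,r})+p_{j,r}\bigr),$$ $$\lambda''_{j,k,r,s}=\frac1{n-2}\sum_{u\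in[n]\setminus\{j,k\}}\sum_{v\in[n]\setminus\{r,s\}}p_{u,v}=\frac1{n-2}\bigl(n(\lambda-\overline{p}_{j,\cdot}-\overline{p}_{k,\cdot}-\overline{p}_{\cdot,r}-\overline{p}_{\cdot,s})+p_{j,r}+p_{k,r}+p_{j,s}+p_{k,s}\bigr).$$
   Context: Setting: $[n]=\{1,\dots,n\}$, and $[n]^2_{\ne}$ is the set of ordered pairs of distinct elements of $[n]$. $X_{j,r}$ ($j,r\in[n]$) are Bernoulli random variables with success probabilities $p_{j,r}\in[0,1]$, $\pi$ is a uniformly distributed random permutation of $[n]$, and all $X_{j,r}$ and $\pi$ are independent. $S_n=\sum_{j=1}^nX_{j,\pi(j)}$, and $P^{S_n}$ is its distribution. Put $\overline{p}_{j,\cdot}=\frac1n\sum_{r=1}^np_{j,r}$, $\overline{p}_{\cdot,r}=\frac1n\sum_{j=1}^np_{j,r}$ and $\lambda=E S_n=\frac1n\sum_{j=1}^n\sum_{r=1}^np_{j,r}$, assumed $>0$. Further $$\gamma''=\frac{1}{2n^2(n-1)}\sum_{(j,k)\in[n]^2_{\ne}}\sum_{(r,s)\in[n]^2_{\ne}}|p_{j,r}-p_{j,s}|\,|p_{k,r}-p_{k,s}|.$$ $\mathrm{Po}(t)$ is the Poisson distribution with mean $t$; $\delta_m$ is the Dirac measure at $m$; $*$ is convolution. With $\mathbb Z_+=\{0,1,2,\dots\}$, $Q_2$ is the finite signed measure on $\mathbb Z_+$ given for $A\subseteq\mathbb Z_+$ by $$Q_2(A)=\mathrm{Po}(\lambda)(A)-\tfrac12(\lambda-\mathrm{Var}\,S_n)\bigl((\delta_1-\delta_0)^{*2}*\mathrm{Po}(\lambda)\bigr)(A)=\sum_{k\in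 A}e^{-\lambda}\frac{\lambda^k}{k!}\Bigl(1-\frac{1}{2\lambda^2}(\lambda-\mathrm{Var}\,S_n)(\lambda^2-2k\lambda+k(k-1))\Bigr).$$ For finite signed measures $Q,Q'$ on $\mathbb Z_+$, $d_{\mathrm{TV}}(Q,Q')=\sup_{A\subseteq\mathbb Z_+}|Q(A)-Q'(A)|$. *)

theory Defs
  imports "HOL-Probability.Probability" "HOL-Combinatorics.Permutations"
begin

definition perms :: "nat \<Rightarrow> (nat \<Rightarrow> nat) set" where
  "perms n = {\<sigma>. \<sigma> permutes {1..n}}"

definition offdiag :: "nat \<Rightarrow> (nat \<times> nat) set" where
  "offdiag n = {(j, k). j \<in> {1..n} \<and> k \<in> {1..n} \<and> j \<noteq> k}"

(* The X j r and pi have different value types, so the mutual independence of the whole family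
   is stated for the sigma-algebras they generate; the index None stands for pi. *)
definition indep_matrix_perm ::
  "'a measure \<Rightarrow> nat \<Rightarrow> (nat \<Rightarrow> nat \<Rightarrow> 'a \<Rightarrow> nat) \<Rightarrow> ('a \<Rightarrow> nat \<Rightarrow> nat) \<Rightarrow> bool" where
  "indep_matrix_perm M n X \<pi> \<longleftrightarrow>
     prob_space.indep_sets M
       (\<lambda>i. case i of
              None \<Rightarrow> {\<pi> -` B \<inter> space M | B. B \<subseteq> perms n}
            | Some (j, r) \<Rightarrow> {X j r -` B \<inter> space M | B. B \<subseteq> UNIV})
       (insert None (Some ` ({1..n} \<times> {1..n})))"

locale bernoulli_matrix_perm = prob_space M
  for M :: "'a measure" +
  fixes n :: nat
    and p :: "nat \<Rightarrow> nat \<Rightarrow> real"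
    and X :: "nat \<Rightarrow> nat \<Rightarrow> 'a \<Rightarrow> nat"
    and \<pi> :: "'a \<Rightarrow> nat \<Rightarrow> nat"
  assumes p_range: "\<And>j r. j \<in> {1..n} \<Longrightarrow> r \<in> {1..n} \<Longrightarrow> p j r \<in> {0..1}"
    and X_measurable: "\<And>j r. j \<in> {1..n} \<Longrightarrow> r \<in> {1..n} \<Longrightarrow> X j r \<in> M \<rightarrow>\<^sub>M count_space UNIV"
    and X_bernoulli: "\<And>j r. j \<in> {1..n} \<Longrightarrow> r \<in> {1..n} \<Longrightarrow>
      distr M (count_space UNIV) (X j r) = measure_pmf (map_pmf of_bool (bernoulli_pmf (p j r)))"
    and \<pi>_measurable: "\<pi> \<in> M \<rightarrow>\<^sub>M count_space (perms n)"
    and \<pi>_uniform: "distr M (count_space (perms n)) \<pi> = uniform_count_measure (perms n)"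
    and indep: "indep_matrix_perm M n X \<pi>"

definition diag_sum ::
  "nat \<Rightarrow> (nat \<Rightarrow> nat \<Rightarrow> 'a \<Rightarrow> nat) \<Rightarrow> ('a \<Rightarrow> nat \<Rightarrow> nat) \<Rightarrow> 'a \<Rightarrow> nat" where
  "diag_sum n X \<pi> \<omega> = (\<Sum>j=1..n. X j (\<pi> \<omega> j) \<omega>)"

definition row_mean :: "nat \<Rightarrow> (nat \<Rightarrow> nat \<Rightarrow> real) \<Rightarrow> nat \<Rightarrow> real" where
  "row_mean n p j = 1 / real n * (\<Sum>r=1..n. p j r)"

definition col_mean :: "nat \<Rightarrow> (nat \<Rightarrow> nat \<Rightarrow> real) \<Rightarrow> nat \<Rightarrow> real" where
  "col_mean n p r = 1 / real n * (\<Sum>j=1..n. p j r)"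

definition lam :: "nat \<Rightarrow> (nat \<Rightarrow> nat \<Rightarrow> real) \<Rightarrow> real" where
  "lam n p = 1 / real n * (\<Sum>j=1..n. \<Sum>r=1..n. p j r)"

definition lam1 :: "nat \<Rightarrow> (nat \<Rightarrow> nat \<Rightarrow> real) \<Rightarrow> nat \<Rightarrow> nat \<Rightarrow> real" where
  "lam1 n p j r = 1 / (real n - 1) * (\<Sum>u\<in>{1..n} - {j}. \<Sum>v\<in>{1..n} - {r}. p u v)"

definition lam2 :: "nat \<Rightarrow> (nat \<Rightarrow> nat \<Rightarrow> real) \<Rightarrow> nat \<Rightarrow> nat \<Rightarrow> nat \<Rightarrow> nat \<Rightarrow> real" where
  "lam2 n p j k r s =
     1 / (real n - 2) * (\<Sum>u\<in>{1..n} - {j, k}. \<Sum>v\<in>{1..n} - {r, s}. p u v)"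

definition gam2 :: "nat \<Rightarrow> (nat \<Rightarrow> nat \<Rightarrow> real) \<Rightarrow> real" where
  "gam2 n p = 1 / (2 * (real n)\<^sup>2 * (real n - 1)) *
     (\<Sum>(j, k)\<in>offdiag n. \<Sum>(r, s)\<in>offdiag n. \<bar>p j r - p j s\<bar> * \<bar>p k r - p k s\<bar>)"

definition eps1 :: "nat \<Rightarrow> (nat \<Rightarrow> nat \<Rightarrow> real) \<Rightarrow> real" where
  "eps1 n p = 2 / real n *
     (\<Sum>j=1..n. \<Sum>r=1..n. row_mean n p j * p j r * \<bar>lam n p - lam1 n p j r\<bar>)"

definition eps2 :: "nat \<Rightarrow> (nat \<Rightarrow> nat \<Rightarrow> real) \<Rightarrow> real" where
  "eps2 n p = 1 / ((real n)\<^sup>2 * (real n - 1)) *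
     (\<Sum>(j, k)\<in>offdiag n. \<Sum>(r, s)\<in>offdiag n.
        \<bar>p j r - p j s\<bar> * \<bar>p k r - p k s\<bar> * \<bar>lam n p - lam2 n p j k r s\<bar>)"

definition eps3 :: "nat \<Rightarrow> (nat \<Rightarrow> nat \<Rightarrow> real) \<Rightarrow> real" where
  "eps3 n p = 2 * (real n)\<^sup>2 / (real n - 2)\<^sup>2 *
     ((real n - 2) / (real n - 1) * (\<Sum>j=1..n. (row_mean n p j)\<^sup>2)
       + sqrt ((real n - 1) / (real n - 3)) * gam2 n p)\<^sup>2"

definition eps :: "nat \<Rightarrow> (nat \<Rightarrow> nat \<Rightarrow> real) \<Rightarrow> real" where
  "eps n p = min 1 (sqrt (2 / (lam n p * exp 1))) * (eps1 n p + eps2 n p)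
     + (1 - exp (- lam n p)) / lam n p * eps3 n p"

lemma lam1_eq:
  assumes "n \<ge> 2" "j \<in> {1..n}" "r \<in> {1..n}"
  shows "lam1 n p j r =
    1 / (real n - 1) * (real n * (lam n p - row_mean n p j - col_mean n p r) + p j r)"
proof -
  have n: "real n \<noteq> 0" using assms by simp
  have "(\<Sum>u\<in>{1..n} - {j}. \<Sum>v\<in>{1..n} - {r}. p u v)
     = (\<Sum>u=1..n. \<Sum>v=1..n. p u v) - (\<Sum>v=1..n. p j v) - (\<Sum>u=1..n. p u r) + p j r"
    using assms(2,3) by (simp add: sum_diff1 sum_subtractf)
  also have "\<dots> = real n * (lam n p - row_mean n p j - col_mean n p r) + p j r"
    using n by (simp add: lam_def row_mean_def col_mean_def algebra_simps)
  finally show ?thesis by (simp add: lam1_def)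
qed

lemma lam2_eq:
  assumes "n \<ge> 3" "(j, k) \<in> offdiag n" "(r, s) \<in> offdiag n"
  shows "lam2 n p j k r s =
    1 / (real n - 2) *
      (real n * (lam n p - row_mean n p j - row_mean n p k - col_mean n p r - col_mean n p s)
        + p j r + p k r + p j s + p k s)"
proof -
  have n: "real n \<noteq> 0" using assms by simp
  have d: "sum f ({1..n} - {a, b}) = sum f {1..n} - f a - f b" if "(a, b) \<in> offdiag n"
    for f :: "nat \<Rightarrow> real" and a b
    using that by (auto simp: offdiag_def sum_diff)
  have "(\<Sum>u\<in>{1..n} - {j, k}. \<Sum>v\<in>{1..n} - {r, s}. p u v)
     = (\<Sum>u=1..n. \<Sum>v=1..n. p u v) - (\<Sum>v=1..n. p j v) - (\<Sum>v=1..n. p k v)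
       - (\<Sum>u=1..n. p u r) - (\<Sum>u=1..n. p u s) + p j r + p k r + p j s + p k s"
    unfolding d[OF assms(2)] d[OF assms(3)] by (simp add: sum_subtractf)
  also have "\<dots> = real n *
      (lam n p - row_mean n p j - row_mean n p k - col_mean n p r - col_mean n p s)
        + p j r + p k r + p j s + p k s"
    using n by (simp add: lam_def row_mean_def col_mean_def algebra_simps)
  finally show ?thesis by (simp add: lam2_def)
qed

lemma card_perms_value:
  assumes "j \<in> {1..n}" "r \<in> {1..n}"
  shows "real (card {\<sigma> \<in> perms n. \<sigma> j = r}) = real (card (perms n)) / real n"
proof -
  let ?C = "\<lambda>r. {\<sigma> \<in> perms n. \<sigma> j = r}"
  have fin: "finite (perms n)" by (simp add: perms_def finite_permutations)
  have le: "card (?C r) \<le> card (?C s)" if "r \<in> {1..n}" "s \<in> {1..n}" for r s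
  proof (rule card_inj_on_le[where f = "\<lambda>\<sigma>. Transposition.transpose r s \<circ> \<sigma>"])
    show "inj_on (\<lambda>\<sigma>. Transposition.transpose r s \<circ> \<sigma>) (?C r)"
      by (rule inj_onI) (metis comp_assoc id_comp transpose_comp_involutory)
    show "(\<lambda>\<sigma>. Transposition.transpose r s \<circ> \<sigma>) ` ?C r \<subseteq> ?C s"
      using that by (auto simp: perms_def intro!: permutes_compose permutes_swap_id)
    show "finite (?C s)" using fin by simp
  qed
  have eq: "card (?C s) = card (?C r)" if "s \<in> {1..n}" for s
    using le[OF assms(2) that] le[OF that assms(2)] by simp
  have "perms n = (\<Union>s\<in>{1..n}. ?C s)"
    using assms(1) permutes_in_image unfolding perms_def by fastforce
  hence "card (perms n) = card (\<Union>s\<in>{1..n}. ?C s)" by simp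
  also have "\<dots> = (\<Sum>s\<in>{1..n}. card (?C s))"
    using fin by (intro card_UN_disjoint) auto
  also have "\<dots> = n * card (?C r)" using eq by simp
  finally show ?thesis using assms by simp
qed

lemma (in bernoulli_matrix_perm) expectation_diag_sum:
  shows "expectation (\<lambda>\<omega>. real (diag_sum n X \<pi> \<omega>)) = lam n p"
proof -
  have fin: "finite (perms n)" by (simp add: perms_def finite_permutations)
  have ne: "perms n \<noteq> {}" using permutes_id[of "{1..n}"] unfolding perms_def by blast
  let ?P = "\<lambda>j r. {\<omega> \<in> space M. \<pi> \<omega> j = r}"
  let ?E = "\<lambda>j r. {\<omega> \<in> space M. X j r \<omega> = 1}"
  have \<pi>in: "\<pi> \<omega> \<in> perms n" if "\<omega> \<in> space M" for \<omega>
    using measurable_space[OF \<pi>_measurable that] by simp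
  have Peq: "?P j r = \<pi> -` {\<sigma> \<in> perms n. \<sigma> j = r} \<inter> space M" for j r using \<pi>in by auto
  have Eeq: "?E j r = X j r -` {1} \<inter> space M" for j r by auto
  have Pm: "?P j r \<in> events" for j r
    unfolding Peq by (rule measurable_sets[OF \<pi>_measurable]) auto
  have Em: "?E j r \<in> events" if "j \<in> {1..n}" "r \<in> {1..n}" for j r
    unfolding Eeq by (rule measurable_sets[OF X_measurable[OF that]]) auto
  have pP: "prob (?P j r) = 1 / real n" if "j \<in> {1..n}" "r \<in> {1..n}" for j r
  proof -
    have "prob (?P j r) = measure (uniform_count_measure (perms n)) {\<sigma> \<in> perms n. \<sigma> j = r}"
      unfolding Peq \<pi>_uniform[symmetric]
      by (subst measure_distr[OF \<pi>_measurable]) auto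
    also have "\<dots> = card {\<sigma> \<in> perms n. \<sigma> j = r} / card (perms n)"
      using fin by (subst measure_uniform_count_measure) auto
    finally show ?thesis using card_perms_value[OF that] fin ne by simp
  qed
  have pX: "prob (X j r -` B \<inter> space M) = measure_pmf.prob (map_pmf of_bool (bernoulli_pmf (p j r))) B"
    if "j \<in> {1..n}" "r \<in> {1..n}" for j r B
    unfolding X_bernoulli[OF that, symmetric]
    by (rule measure_distr[OF X_measurable[OF that], symmetric]) simp
  have pE: "prob (?E j r) = p j r" if "j \<in> {1..n}" "r \<in> {1..n}" for j r
  proof -
    have "(of_bool -` {1::nat}) = {True}" by (auto simp: vimage_def of_bool_def split: if_splits)
    thus ?thesis
      unfolding Eeq pX[OF that] measure_map_pmf using p_range[OF that]
      by (simp add: measure_pmf_single)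
  qed
  have ind: "prob (?P j r \<inter> ?E j r) = prob (?P j r) * prob (?E j r)"
    if "j \<in> {1..n}" "r \<in> {1..n}" for j r
  proof -
    let ?A = "\<lambda>i. case i of None \<Rightarrow> ?P j r | Some _ \<Rightarrow> ?E j r"
    have "prob (\<Inter>i\<in>{None, Some (j, r)}. ?A i) = (\<Prod>i\<in>{None, Some (j, r)}. prob (?A i))"
      by (rule indep_setsD[OF indep[unfolded indep_matrix_perm_def]])
         (use that in \<open>auto simp: Peq Eeq intro!: exI[of _ "{\<sigma> \<in> perms n. \<sigma> j = r}"] exI[of _ "{1}"]\<close>)
    thus ?thesis by simp
  qed
  have AE01: "AE \<omega> in M. X j r \<omega> \<in> {0, 1}" if "j \<in> {1..n}" "r \<in> {1..n}" for j r
  proof -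
    have "(of_bool -` {0,1::nat}) = UNIV" by (auto simp: vimage_def of_bool_def)
    hence "prob (X j r -` {0,1} \<inter> space M) = 1" unfolding pX[OF that] measure_map_pmf by simp
    from AE_prob_1[OF this] show ?thesis by (rule AE_mp) (intro AE_I2, auto)
  qed
  let ?f = "\<lambda>\<omega>. \<Sum>j=1..n. \<Sum>r=1..n. indicator (?P j r \<inter> ?E j r) \<omega> :: real"
  have "AE \<omega> in M. \<forall>j\<in>{1..n}. \<forall>r\<in>{1..n}. X j r \<omega> \<in> {0, 1}"
    by (intro AE_finite_allI finite_atLeastAtMost AE01)
  hence ae: "AE \<omega> in M. real (diag_sum n X \<pi> \<omega>) = ?f \<omega>"
  proof (rule AE_mp[OF _ AE_I2], intro impI)
    fix \<omega> assume \<omega>: "\<omega> \<in> space M" and 01: "\<forall>j\<in>{1..n}. \<forall>r\<in>{1..n}. X j r \<omega> \<in> {0, 1}"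
    have "real (X j (\<pi> \<omega> j) \<omega>) = (\<Sum>r=1..n. indicator (?P j r \<inter> ?E j r) \<omega>)" if j: "j \<in> {1..n}" for j
    proof -
      have \<pi>j: "\<pi> \<omega> j \<in> {1..n}" using \<pi>in[OF \<omega>] j permutes_in_image unfolding perms_def by fastforce
      have "(\<Sum>r=1..n. indicator (?P j r \<inter> ?E j r) \<omega>) = (\<Sum>r=1..n. if r = \<pi> \<omega> j then real (X j r \<omega>) else 0)"
        using 01 j \<omega> by (intro sum.cong) (force simp: indicator_def)+
      thus ?thesis using \<pi>j by simp
    qed
    thus "real (diag_sum n X \<pi> \<omega>) = ?f \<omega>" by (simp add: diag_sum_def)
  qed
  have Dm: "(\<lambda>\<omega>. real (diag_sum n X \<pi> \<omega>)) \<in> borel_measurable M"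
  proof -
    have "(\<lambda>\<omega>. real (diag_sum n X \<pi> \<omega>)) \<in> borel_measurable M \<longleftrightarrow>
      (\<lambda>\<omega>. \<Sum>j=1..n. \<Sum>r=1..n. indicator (?P j r) \<omega> * real (X j r \<omega>)) \<in> borel_measurable M"
    proof (rule measurable_cong)
      fix \<omega> assume \<omega>: "\<omega> \<in> space M"
      have "real (X j (\<pi> \<omega> j) \<omega>) = (\<Sum>r=1..n. indicator (?P j r) \<omega> * real (X j r \<omega>))"
        if j: "j \<in> {1..n}" for j
      proof -
        have \<pi>j: "\<pi> \<omega> j \<in> {1..n}" using \<pi>in[OF \<omega>] j permutes_in_image unfolding perms_def by fastforce
        have "(\<Sum>r=1..n. indicator (?P j r) \<omega> * real (X j r \<omega>)) = (\<Sum>r=1..n. if r = \<pi> \<omega> j then real (X j r \<omega>) else 0)"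
          using j \<omega> by (intro sum.cong) (auto simp: indicator_def)
        thus ?thesis using \<pi>j by simp
      qed
      thus "real (diag_sum n X \<pi> \<omega>) = (\<Sum>j=1..n. \<Sum>r=1..n. indicator (?P j r) \<omega> * real (X j r \<omega>))"
        by (simp add: diag_sum_def)
    qed
    also have "\<dots>"
      using Pm by (intro borel_measurable_sum borel_measurable_times borel_measurable_indicator
          measurable_compose[OF X_measurable]) auto
    finally show ?thesis .
  qed
  have "expectation (\<lambda>\<omega>. real (diag_sum n X \<pi> \<omega>)) = expectation ?f"
  proof (rule integral_cong_AE[OF Dm _ ae])
    show "?f \<in> borel_measurable M"
    proof (rule borel_measurable_sum, rule borel_measurable_sum)
      fix j r assume "j \<in> {1..n}" "r \<in> {1..n}"
      from sets.Int[OF Pm Em[OF this]]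
      show "indicator (?P j r \<inter> ?E j r) \<in> borel_measurable M"
        by (rule borel_measurable_indicator)
    qed
  qed
  also have "\<dots> = (\<Sum>j=1..n. \<Sum>r=1..n. prob (?P j r \<inter> ?E j r))"
  proof -
    have i: "integrable M (indicator (?P j r \<inter> ?E j r) :: _ \<Rightarrow> real)"
      if "j \<in> {1..n}" "r \<in> {1..n}" for j r
      using Pm Em[OF that] by (intro integrable_real_indicator) (auto simp: emeasure_eq_measure)
    have "expectation ?f = (\<Sum>j=1..n. \<Sum>r=1..n. expectation (indicator (?P j r \<inter> ?E j r)))"
      using i by (subst Bochner_Integration.integral_sum, force intro!: Bochner_Integration.integrable_sum)
                 (intro sum.cong refl Bochner_Integration.integral_sum, auto)
    also have "\<dots> = (\<Sum>j=1..n. \<Sum>r=1..n. prob (?P j r \<inter> ?E j r))"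
      using Pm Em by (intro sum.cong refl) (simp add: Int_absorb2 Int_assoc sets.sets_into_space Bochner_Integration.integral_indicator)
    finally show ?thesis .
  qed
  also have "\<dots> = (\<Sum>j=1..n. \<Sum>r=1..n. 1 / real n * p j r)"
    using ind pP pE by (intro sum.cong refl) auto
  also have "\<dots> = lam n p" by (simp add: lam_def sum_distrib_left)
  finally show ?thesis .
qed

(* A finite signed measure on the nonnegative integers is represented by its set function
   nat set => real. *)

definition dirac :: "nat \<Rightarrow> nat set \<Rightarrow> real" where
  "dirac m A = indicator A m"

definition Po :: "real \<Rightarrow> nat set \<Rightarrow> real" where
  "Po t A = measure (measure_pmf (poisson_pmf t)) A"

definition conv :: "(nat set \<Rightarrow> real) \<Rightarrow> (nat set \<Rightarrow> real) \<Rightarrow> nat set \<Rightarrow> real" where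
  "conv Q R A = (\<Sum>\<^sub>\<infinity>(k, l)\<in>{(k, l). k + l \<in> A}. Q {k} * R {l})"

(* With t = lambda and v = Var S_n; the density form is Q2_eq. *)
definition Q2 :: "real \<Rightarrow> real \<Rightarrow> nat set \<Rightarrow> real" where
  "Q2 t v A = Po t A
     - 1 / 2 * (t - v) *
       conv (conv (\<lambda>B. dirac 1 B - dirac 0 B) (\<lambda>B. dirac 1 B - dirac 0 B)) (Po t) A"

lemma has_sum_diff_real:
  fixes f g :: "'b \<Rightarrow> real"
  assumes "(f has_sum a) A" "(g has_sum b) A"
  shows "((\<lambda>x. f x - g x) has_sum (a - b)) A"
  using has_sum_add[OF assms(1) has_sum_cmult_right[OF assms(2), of "-1"]] by simp

lemma Po_has_sum:
  "((\<lambda>k. Po t {k}) has_sum Po t A) A"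
proof -
  have 1: "integrable (count_space A) (pmf (poisson_pmf t))"
    by (rule integrable_pmf)
  hence "Po t A = infsetsum (pmf (poisson_pmf t)) A"
    by (simp add: Po_def measure_pmf_conv_infsetsum)
  moreover have s: "Infinite_Set_Sum.abs_summable_on (pmf (poisson_pmf t)) A" using 1
    by (simp add: Infinite_Set_Sum.abs_summable_on_def)
  ultimately have "Po t A = infsum (pmf (poisson_pmf t)) A" by (simp add: infsetsum_infsum)
  moreover have "pmf (poisson_pmf t) summable_on A"
    using s abs_summable_equivalent abs_summable_summable by blast
  ultimately show ?thesis by (simp add: Po_def measure_pmf_single)
qed

lemma conv_finite_support:
  assumes "finite F" "\<And>k. k \<notin> F \<Longrightarrow> Q {k} = 0"
    and "\<And>B. ((\<lambda>l. R {l}) has_sum R B) B"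
  shows "conv Q R A = (\<Sum>k\<in>F. Q {k} * R {l. k + l \<in> A})"
proof -
  have 0: "((\<lambda>(k, l). Q {k} * R {l}) has_sum (\<Sum>k\<in>F. Q {k} * R {l. k + l \<in> A}))
     (Sigma F (\<lambda>k. {l. k + l \<in> A}))"
    using assms(1)
  proof (induction F)
    case empty thus ?case by simp
  next
    case (insert x F)
    have "((\<lambda>l. Q {x} * R {l}) has_sum (Q {x} * R {l. x + l \<in> A})) {l. x + l \<in> A}"
      by (rule has_sum_cmult_right[OF assms(3)])
    hence "((\<lambda>(k, l). Q {k} * R {l}) has_sum (Q {x} * R {l. x + l \<in> A})) (Pair x ` {l. x + l \<in> A})"
      by (subst has_sum_reindex) (auto simp: o_def inj_on_def)
    from has_sum_Un_disjoint[OF this insert.IH]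
    have "((\<lambda>(k, l). Q {k} * R {l}) has_sum
        (Q {x} * R {l. x + l \<in> A} + (\<Sum>k\<in>F. Q {k} * R {l. k + l \<in> A})))
        (Pair x ` {l. x + l \<in> A} \<union> Sigma F (\<lambda>k. {l. k + l \<in> A}))"
      using insert.hyps by auto
    moreover have "Pair x ` {l. x + l \<in> A} \<union> Sigma F (\<lambda>k. {l. k + l \<in> A})
       = Sigma (insert x F) (\<lambda>k. {l. k + l \<in> A})" by auto
    ultimately show ?case using insert.hyps by simp
  qed
  have "conv Q R A = infsum (\<lambda>(k, l). Q {k} * R {l}) (Sigma F (\<lambda>k. {l. k + l \<in> A}))"
    unfolding conv_def by (rule infsum_cong_neutral) (use assms(2) in force)+
  with infsumI[OF 0] show ?thesis by simp
qed

lemma dirac_has_sum: "((\<lambda>l. dirac 1 {l} - dirac 0 {l}) has_sum (dirac 1 B - dirac 0 B)) B"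
proof -
  have "((\<lambda>l. dirac m {l}) has_sum dirac m B) B" for m
  proof -
    have "((\<lambda>l. dirac m {l}) has_sum (\<Sum>l\<in>B \<inter> {m}. dirac m {l})) (B \<inter> {m})"
      by (rule has_sum_finite) auto
    moreover have "(\<Sum>l\<in>B \<inter> {m}. dirac m {l}) = dirac m B"
      by (cases "m \<in> B") (auto simp: dirac_def)
    ultimately show ?thesis
      by (subst has_sum_cong_neutral[where T="B \<inter> {m}"]) (auto simp: dirac_def)
  qed
  from has_sum_diff_real[OF this this] show ?thesis .
qed

lemma conv_dirac_Po:
  "conv (conv (\<lambda>B. dirac 1 B - dirac 0 B) (\<lambda>B. dirac 1 B - dirac 0 B)) (Po t) A
   = Po t A - 2 * Po t {l. l + 1 \<in> A} + Po t {l. l + 2 \<in> A}"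
proof -
  let ?D = "\<lambda>B. dirac 1 B - dirac 0 B"
  have c: "conv ?D ?D B = dirac 0 B - 2 * dirac 1 B + dirac 2 B" for B
    by (subst conv_finite_support[where F = "{0, 1}"])
       (auto simp: dirac_has_sum[simplified], auto simp: dirac_def indicator_def numeral_2_eq_2)
  show ?thesis
    by (subst conv_finite_support[where F = "{0, 1, 2}"], unfold c)
       (auto simp: Po_has_sum dirac_def)
qed

lemma Po_shift_has_sum:
  "((\<lambda>k. if i \<le> k then Po t {k - i} else 0) has_sum Po t {l. l + i \<in> A}) A"
proof -
  have "((\<lambda>k. if i \<le> k then Po t {k - i} else 0) has_sum Po t {l. l + i \<in> A})
     ((\<lambda>l. l + i) ` {l. l + i \<in> A})"
    using Po_has_sum[of t "{l. l + i \<in> A}"]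
    by (subst has_sum_reindex) (auto simp: o_def inj_on_def)
  moreover have "x \<in> (\<lambda>l. l + i) ` {l. l + i \<in> A}" if "x \<in> A" "i \<le> x" for x
    using that by (intro image_eqI[of _ _ "x - i"]) auto
  ultimately show ?thesis
    by (subst (asm) has_sum_cong_neutral[where T=A and g = "\<lambda>k. if i \<le> k then Po t {k - i} else 0"]) auto
qed

lemma Q2_eq:
  assumes "t > 0"
  shows "Q2 t v A = (\<Sum>\<^sub>\<infinity>k\<in>A. exp (- t) * t ^ k / fact k *
    (1 - 1 / (2 * t\<^sup>2) * (t - v) * (t\<^sup>2 - 2 * real k * t + real k * (real k - 1))))"
proof -
  let ?g = "\<lambda>i k. if i \<le> k then Po t {k - i} else 0"
  have "((\<lambda>k. ?g 0 k - 1 / 2 * (t - v) * (?g 0 k - 2 * ?g 1 k + ?g 2 k)) has_sum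
     (Po t A - 1 / 2 * (t - v) * (Po t A - 2 * Po t {l. l + 1 \<in> A} + Po t {l. l + 2 \<in> A}))) A"
    by (intro has_sum_diff_real has_sum_add has_sum_cmult_right Po_shift_has_sum)
       (use Po_shift_has_sum[of 0 t A] in simp_all)
  from infsumI[OF this]
  have "Q2 t v A = (\<Sum>\<^sub>\<infinity>k\<in>A. ?g 0 k - 1 / 2 * (t - v) * (?g 0 k - 2 * ?g 1 k + ?g 2 k))"
    unfolding Q2_def conv_dirac_Po by (rule sym)
  also have "\<dots> = (\<Sum>\<^sub>\<infinity>k\<in>A. exp (- t) * t ^ k / fact k *
    (1 - 1 / (2 * t\<^sup>2) * (t - v) * (t\<^sup>2 - 2 * real k * t + real k * (real k - 1))))"
  proof (rule infsum_cong)
    fix k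
    have P: "Po t {m} = exp (- t) * t ^ m / fact m" for m
      using assms by (simp add: Po_def measure_pmf_single)
    let ?w = "exp (- t) * t ^ k / fact k"
    have g0: "?g 0 k = ?w" by (simp add: P)
    have g1: "?g 1 k = ?w * (real k / t)"
    proof (cases k)
      case (Suc m)
      have "e * (t * a) / (c * f) * (c / t) = e * a / f" if "c \<noteq> 0" for e a c f :: real
        using that assms by simp
      from this[of "real (Suc m)" "exp (- t)" "t ^ m" "fact m"]
      show ?thesis unfolding Suc by (simp only: P fact_Suc power_Suc) simp
    qed simp
    have g2: "?g 2 k = ?w * (real k * (real k - 1) / t\<^sup>2)"
    proof (cases "k \<ge> 2")
      case True
      then obtain m where m: "k = Suc (Suc m)" by (metis add_2_eq_Suc le_Suc_ex)
      have "e * (t * (t * a)) / (c * (d * f)) * (c * d / t\<^sup>2) = e * a / f"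
        if "c \<noteq> 0" "d \<noteq> 0" for e a c d f :: real
        using that assms by (simp add: power2_eq_square)
      from this[of "real (Suc (Suc m))" "real (Suc m)" "exp (- t)" "t ^ m" "fact m"]
      show ?thesis unfolding m by (simp only: P fact_Suc power_Suc) simp
    next
      case False
      hence "k = 0 \<or> k = 1" by auto
      thus ?thesis by auto
    qed
    have "?g 0 k - 1 / 2 * (t - v) * (?g 0 k - 2 * ?g 1 k + ?g 2 k)
      = ?w * (1 - 1 / 2 * (t - v) * (1 - 2 * (real k / t) + real k * (real k - 1) / t\<^sup>2))"
    proof -
      have "w - c * d * (w - 2 * (w * x) + w * (y / z)) = w * (1 - c * d * (1 - 2 * x + y / z))"
        for w c d x y z :: real
        by (simp only: ring_distribs mult.assoc mult.left_commute mult.commute)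
      thus ?thesis unfolding g0 g1 g2 .
    qed
    also have "1 / 2 * (t - v) * (1 - 2 * (real k / t) + real k * (real k - 1) / t\<^sup>2)
      = 1 / (2 * t\<^sup>2) * (t - v) * (t\<^sup>2 - 2 * real k * t + real k * (real k - 1))"
    proof -
      have "1 - 2 * (real k / t) + real k * (real k - 1) / t\<^sup>2
         = (t\<^sup>2 - 2 * real k * t + real k * (real k - 1)) / t\<^sup>2"
        using assms by (simp add: add_divide_distrib diff_divide_distrib power2_eq_square)
      thus ?thesis by simp
    qed
    finally show "?g 0 k - 1 / 2 * (t - v) * (?g 0 k - 2 * ?g 1 k + ?g 2 k) = ?w *
      (1 - 1 / (2 * t\<^sup>2) * (t - v) * (t\<^sup>2 - 2 * real k * t + real k * (real k - 1)))" .
  qed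
  finally show ?thesis .
qed

(* The supremum is over a bounded set when Q and Q' are finite signed measures. *)
definition dTV :: "(nat set \<Rightarrow> real) \<Rightarrow> (nat set \<Rightarrow> real) \<Rightarrow> real" where
  "dTV Q Q' = (SUP A. \<bar>Q A - Q' A\<bar>)"

end

theory Submission
  imports Defs
begin

text \<open>
The proof is a second-order version of the Stein-Chen method. Write \<open>g\<close> for the solution of
\<open>t * g (x + 1) - x * g x = 1_A x - Po(t) A\<close> with \<open>t = lam n p\<close>, and \<open>f x = g (x + 2) - g (x + 1)\<close>.

The law of a random diagonal sum can be expanded along a row or along a column of the matrix, as a
permanent can. A row expansion combined with antisymmetrisation in two columns, followed by a column
expansion, turns the Stein operator of a random diagonal sum \<open>S\<close> with mean \<open>\<mu>\<close> into an exact sum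
(\<open>stein_identity\<close>): \<open>E (\<mu> * g (S + 1) - S * g S)\<close> is a combination, with nonnegative weights of
total mass \<open>row_sq\<close>, of the numbers \<open>E f S'\<close>, plus a combination, with signed weights of total
absolute mass \<open>pair_dev\<close>, of the numbers \<open>E f S''\<close>. Here \<open>S'\<close> and \<open>S''\<close> are the random diagonal
sums of the matrix with one row and one column removed, respectively with two rows and two columns
removed. For \<open>g\<close> the identity, the same formula says that the weights add up to
\<open>lam n p - Var S\<close> (\<open>variance_diag_sum\<close>).

On the other side, if \<open>Z\<close> is a Poisson variable with mean \<open>t\<close>, then \<open>E f Z\<close> is \<open>-1/2\<close> times the value
at \<open>A\<close> of the second difference of the Poisson law, so that the correction term in \<open>Q2\<close> is
\<open>(lam n p - Var S) * E f Z\<close> (\<open>Q2_eq_stein\<close>). Consequently \<open>P (S \<in> A) - Q2 A\<close> is the weighted sum of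
the differences \<open>E f S' - E f Z\<close> and \<open>E f S'' - E f Z\<close>. Each of them is estimated by a second
application of Stein's method, again with the Poisson mean \<open>t\<close> although \<open>S'\<close> and \<open>S''\<close> have the means
\<open>lam1\<close> and \<open>lam2\<close> (\<open>diag_exp_poisson_approx\<close>). The discrepancy of the means is multiplied by a bound
for the Stein solution and gives \<open>eps1\<close> and \<open>eps2\<close>; the rest is multiplied by a bound for the
increments of the Stein solution and gives \<open>eps3\<close>, once the weights of the smaller matrices are
compared with those of the full one.

Two properties of the Stein solution for a function with values in \<open>[0,1]\<close> are needed: its increments
are at most \<open>(1 - exp (- t)) / t\<close> in absolute value (\<open>stein_diff_bound\<close>, for positive arguments), and
the solution itself is at most
\<open>min 1 (sqrt (2 / (t * exp 1)))\<close> (\<open>stein_bound\<close>). The former is read off from an explicit formula. The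
latter follows from an integral representation along the immigration-death process and from the bound
\<open>1 / sqrt (2 * exp 1 * s)\<close> for the point masses of the Poisson law with mean \<open>s\<close>.
\<close>

section \<open>Poisson expectations\<close>

text \<open>
The Poisson weight, defined by its formula for every real \<open>t\<close>; it is a probability only for
\<open>t \<ge> 0\<close>. The case \<open>t = 0\<close>, the unit mass at 0, is needed for the integral representation of the
Stein solution.
\<close>

definition pois :: "real \<Rightarrow> nat \<Rightarrow> real" where
  "pois t k = exp (- t) * t ^ k / fact k"

text \<open>
The expectation of \<open>f\<close> under the Poisson law; all functions it is applied to below are bounded, so the
series converges.
\<close>

definition pois_exp :: "real \<Rightarrow> (nat \<Rightarrow> real) \<Rightarrow> real" where
  "pois_exp t f = (\<Sum>k. pois t k * f k)"

lemma pois_sums: "pois t sums 1"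
  using sums_mult[OF exp_converges[of t], of "exp (- t)"]
  by (simp add: pois_def[abs_def] divide_inverse mult_ac exp_minus_inverse flip: exp_minus)

lemma pois_summable_abs: "summable (\<lambda>k. \<bar>pois t k\<bar>)"
  using summable_mult[OF summable_norm_exp[of t], of "exp (- t)"]
  by (simp add: pois_def[abs_def] divide_inverse abs_mult mult_ac)

lemma pois_pos: "t > 0 \<Longrightarrow> pois t k > 0"
  by (simp add: pois_def)

lemma pois_nonneg: "t \<ge> 0 \<Longrightarrow> pois t k \<ge> 0"
  by (simp add: pois_def)

lemma pois_Suc: "real (Suc k) * pois t (Suc k) = t * pois t k"
proof -
  have "fact (Suc k) = real (Suc k) * fact k" by (rule fact_Suc)
  thus ?thesis unfolding pois_def by (simp del: fact_Suc of_nat_Suc)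
qed

lemma pois_Suc': "pois t (Suc k) = t / real (Suc k) * pois t k"
  using pois_Suc[of k t] by (simp add: field_simps del: of_nat_Suc)

lemma pois_summable:
  assumes "\<And>k. \<bar>f k\<bar> \<le> C"
  shows "summable (\<lambda>k. pois t k * f k)"
proof (rule summable_comparison_test'[OF summable_mult2[OF pois_summable_abs[of t], of C]])
  fix k
  show "norm (pois t k * f k) \<le> \<bar>pois t k\<bar> * C"
    using assms[of k] by (simp add: abs_mult mult_left_mono)
qed

lemma pois_exp_affine:
  assumes "\<And>k. \<bar>f k\<bar> \<le> C"
  shows "pois_exp t (\<lambda>k. a * f k + b) = a * pois_exp t f + b"
proof -
  have 1: "(\<lambda>k. pois t k * f k) sums pois_exp t f"
    unfolding pois_exp_def by (rule summable_sums[OF pois_summable[OF assms]])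
  have "(\<lambda>k. pois t k * (a * f k + b)) sums (a * pois_exp t f + b)"
    using sums_add[OF sums_mult[OF 1, of a] sums_mult[OF pois_sums[of t], of b]]
    by (simp add: algebra_simps)
  thus ?thesis by (simp add: pois_exp_def sums_iff)
qed

lemma pois_exp_add:
  assumes "\<And>k. \<bar>f k\<bar> \<le> C" "\<And>k. \<bar>g k\<bar> \<le> D"
  shows "pois_exp t (\<lambda>k. f k + g k) = pois_exp t f + pois_exp t g"
  using suminf_add[OF pois_summable[of f C t, OF assms(1)] pois_summable[of g D t, OF assms(2)]]
  by (simp add: pois_exp_def algebra_simps)

lemma pois_exp_diff:
  assumes "\<And>k. \<bar>f k\<bar> \<le> C" "\<And>k. \<bar>g k\<bar> \<le> D"
  shows "pois_exp t (\<lambda>k. f k - g k) = pois_exp t f - pois_exp t g"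
  using suminf_diff[OF pois_summable[of f C t, OF assms(1)] pois_summable[of g D t, OF assms(2)]]
  by (simp add: pois_exp_def algebra_simps)

lemma pois_exp_size_bias:
  assumes "\<And>k. \<bar>f k\<bar> \<le> C" "\<And>k. \<bar>real k * f k\<bar> \<le> D"
  shows "pois_exp t (\<lambda>k. real k * f k) = t * pois_exp t (\<lambda>k. f (Suc k))"
proof -
  have "(\<lambda>k. pois t (Suc k) * (real (Suc k) * f (Suc k))) sums (t * pois_exp t (\<lambda>k. f (Suc k)))"
  proof -
    have "(\<lambda>k. pois t k * f (Suc k)) sums pois_exp t (\<lambda>k. f (Suc k))"
      unfolding pois_exp_def by (rule summable_sums[OF pois_summable[OF assms(1)]])
    from sums_mult[OF this, of t] show ?thesis
      by (simp only: mult.assoc[symmetric] pois_Suc[symmetric] mult.commute[of "pois t (Suc _)"])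
  qed
  from sums_Suc[OF this] show ?thesis by (simp add: pois_exp_def sums_iff)
qed

lemma pois_exp_has_derivative:
  assumes "\<And>k. \<bar>f k\<bar> \<le> C"
  shows "((\<lambda>s. pois_exp s f) has_real_derivative pois_exp s (\<lambda>k. f (Suc k) - f k)) (at s)"
proof -
  define c where "c = (\<lambda>k. f k / fact k)"
  have sm: "summable (\<lambda>k. c k * x ^ k)" if "\<And>k. \<bar>g k\<bar> \<le> C" "c = (\<lambda>k. g k / fact k)" for x c and g :: "nat \<Rightarrow> real"
  proof -
    have "summable (\<lambda>k. exp x * (pois x k * g k))"
      by (rule summable_mult[OF pois_summable[OF that(1)]])
    moreover have "exp x * (pois x k * g k) = c k * x ^ k" for k
      by (simp add: pois_def that(2) exp_minus field_simps)
    ultimately show ?thesis by simp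
  qed
  have eq: "pois_exp s g = exp (- s) * (\<Sum>k. c k * s ^ k)"
    if "\<And>k. \<bar>g k\<bar> \<le> C" "c = (\<lambda>k. g k / fact k)" for s c and g :: "nat \<Rightarrow> real"
    unfolding pois_exp_def suminf_mult[OF sm[OF that], symmetric]
    by (simp add: pois_def that(2) field_simps)
  have d: "diffs c = (\<lambda>k. f (Suc k) / fact k)"
    by (rule ext) (simp add: diffs_def c_def del: of_nat_Suc)
  have "((\<lambda>s. exp (- s) * (\<Sum>k. c k * s ^ k)) has_real_derivative
      (- exp (- s) * (\<Sum>k. c k * s ^ k) + (\<Sum>k. diffs c k * s ^ k) * exp (- s))) (at s)"
  proof -
    have e: "((\<lambda>s. exp (- s)) has_real_derivative - exp (- s)) (at s)"
      by (auto intro!: derivative_eq_intros)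
    have "((\<lambda>s. \<Sum>k. c k * s ^ k) has_real_derivative (\<Sum>k. diffs c k * s ^ k)) (at s)"
      by (rule termdiffs_strong_converges_everywhere[OF sm[OF assms c_def]])
    from DERIV_mult[OF e this] show ?thesis by simp
  qed
  moreover have "- exp (- s) * (\<Sum>k. c k * s ^ k) + (\<Sum>k. diffs c k * s ^ k) * exp (- s)
      = pois_exp s (\<lambda>k. f (Suc k)) - pois_exp s f"
    using eq[OF assms c_def, of s] eq[OF assms d, of s] by simp
  moreover have "\<dots> = pois_exp s (\<lambda>k. f (Suc k) - f k)"
    by (rule pois_exp_diff[OF assms assms, symmetric])
  ultimately show ?thesis unfolding eq[OF assms c_def] by simp
qed

section \<open>The mode of the Poisson law\<close>

text \<open>
The Hermite-Hadamard inequality for the concave function \<open>ln\<close> on the interval of length 1 centred at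
\<open>y\<close>: the left side is the mean of \<open>ln\<close> over that interval.
\<close>

lemma hermite_hadamard_ln:
  fixes y :: real
  assumes "y \<ge> 1"
  shows "(y + 1/2) * ln (y + 1/2) - (y - 1/2) * ln (y - 1/2) - 1 \<le> ln y"
proof -
  \<comment> \<open>Over the interval \<open>[y - h, y + h]\<close>, the difference of the integrals of \<open>ln\<close> and of its value
    at the centre decreases in \<open>h\<close>.\<close>
  define F where "F = (\<lambda>h. (y + h) * ln (y + h) - (y - h) * ln (y - h) - 2 * h - 2 * h * ln y)"
  have "F (1/2) \<le> F 0"
  proof (rule DERIV_nonpos_imp_nonincreasing[of 0 "1/2" F])
    fix h :: real assume h: "0 \<le> h" "h \<le> 1/2"
    have pos: "y + h > 0" "y - h > 0" using assms h by auto
    have "(F has_real_derivative (ln (y + h) + ln (y - h) - 2 * ln y)) (at h)"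
      unfolding F_def using pos by (auto intro!: derivative_eq_intros)
    moreover have "ln (y + h) + ln (y - h) \<le> 2 * ln y"
    proof -
      have "ln (y + h) + ln (y - h) = ln ((y + h) * (y - h))" using pos by (simp add: ln_mult)
      also have "\<dots> \<le> ln (y * y)"
        using mult_pos_pos[OF pos] by (intro ln_mono) (auto simp: algebra_simps)
      finally show ?thesis using assms by (simp add: ln_mult)
    qed
    ultimately show "\<exists>d. (F has_real_derivative d) (at h) \<and> d \<le> 0" by fastforce
  qed simp
  thus ?thesis by (simp add: F_def)
qed

lemma pois_sqrt_le:
  assumes "t > 0"
  shows "pois t k \<le> 1 / sqrt (2 * exp 1 * t)"
proof -
  define y where "y = (\<lambda>k. real k + 1/2)"
  have y0: "y k > 0" for k by (simp add: y_def add_nonneg_pos)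
  \<comment> \<open>For fixed \<open>k\<close>, the quantity \<open>sqrt t * pois t k\<close> is maximal at \<open>t = k + 1/2\<close>; these maxima
    decrease in \<open>k\<close>, and the one at \<open>k = 0\<close> is \<open>1 / sqrt (2 * exp 1)\<close>.\<close>
  have max: "y k * ln (y k) - y k - ln (fact k) \<le> - 1/2 - ln 2 / 2" for k
  proof (induction k)
    case 0 thus ?case by (simp add: y_def ln_div)
  next
    case (Suc k)
    have "ln (fact (Suc k)) = ln (real (Suc k)) + ln (fact k)"
      by (simp add: ln_mult del: of_nat_Suc)
    moreover have "y (Suc k) * ln (y (Suc k)) - y k * ln (y k) - 1 \<le> ln (real (Suc k))"
      using hermite_hadamard_ln[of "real (Suc k)"] by (simp add: y_def algebra_simps)
    ultimately show ?case using Suc.IH by (simp add: y_def)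
  qed
  have "y k * ln t - t \<le> y k * ln (y k) - y k"
  proof -
    have "ln (t / y k) \<le> t / y k - 1" using assms y0 by (intro ln_le_minus_one) simp
    hence "y k * (ln t - ln (y k)) \<le> y k * (t / y k - 1)"
      using assms y0[of k] by (intro mult_left_mono) (auto simp: ln_div)
    thus ?thesis using y0[of k] by (simp add: algebra_simps)
  qed
  hence "ln (pois t k) \<le> - 1/2 - ln 2 / 2 - ln t / 2"
    using max[of k] assms by (simp add: pois_def ln_div ln_mult ln_realpow y_def algebra_simps)
  also have "\<dots> = ln (1 / sqrt (2 * exp 1 * t))"
    using assms by (simp add: ln_div ln_sqrt ln_mult field_simps)
  finally show ?thesis using assms pois_pos[OF assms, of k]
    by (subst (asm) ln_le_cancel_iff) auto
qed

text \<open>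
Summation by parts moves the difference onto the weights \<open>w\<close>, which increase up to \<open>m\<close> and decrease
afterwards, so the largest possible value is reached for the indicator function of the numbers above
\<open>m\<close>. The bound is stated for partial sums and carries a boundary term through the induction.
\<close>

lemma unimodal_weighted_diff_le:
  fixes w f :: "nat \<Rightarrow> real"
  assumes up: "\<And>k. k < m \<Longrightarrow> w k \<le> w (Suc k)" and dn: "\<And>k. k \<ge> m \<Longrightarrow> w (Suc k) \<le> w k"
    and w: "\<And>k. w k \<ge> 0" and f: "\<And>k. f k \<in> {0..1}"
  shows "(\<Sum>k\<le>N. w k * (f (Suc k) - f k)) \<le> w m"
proof -
  let ?A = "\<lambda>N. \<Sum>k\<le>N. w k * (f (Suc k) - f k)"
  have 1: "?A N \<le> w N * f (Suc N)" if "N \<le> m" for N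
    using that
  proof (induction N)
    case 0 thus ?case using w[of 0] f[of 0] by (simp add: algebra_simps)
  next
    case (Suc N)
    have "w N * f (Suc N) \<le> w (Suc N) * f (Suc N)"
      using up[of N] Suc.prems f[of "Suc N"] by (intro mult_right_mono) auto
    thus ?case using Suc by (simp add: algebra_simps)
  qed
  have 2: "?A (m + i) \<le> w m - w (m + i) * (1 - f (Suc (m + i)))" for i
  proof (induction i)
    case 0 thus ?case using 1[of m] by (simp add: algebra_simps)
  next
    case (Suc i)
    have "w (Suc (m + i)) * (1 - f (Suc (m + i))) \<le> w (m + i) * (1 - f (Suc (m + i)))"
      using dn[of "m + i"] f[of "Suc (m + i)"] by (intro mult_right_mono) auto
    thus ?case using Suc by (simp add: algebra_simps)
  qed
  show ?thesis
  proof (cases "N \<le> m")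
    case True
    have "?A N \<le> w N * 1"
      using 1[OF True] mult_left_mono[of "f (Suc N)" 1 "w N"] w[of N] f[of "Suc N"] by auto
    also have "w N \<le> w m"
      using True
      by (induction rule: inc_induct) (use up in \<open>auto intro: order_trans\<close>)
    finally show ?thesis by simp
  next
    case False
    then obtain i where i: "N = m + i" by (metis le_add_diff_inverse nat_le_linear)
    have "0 \<le> w N * (1 - f (Suc N))" using w f[of "Suc N"] by simp
    thus ?thesis using 2[of i] unfolding i by linarith
  qed
qed

lemma pois_exp_diff_le_mode:
  assumes "t > 0" and f: "\<And>k. f k \<in> {0..1}"
  shows "\<exists>m. \<bar>pois_exp t (\<lambda>k. f (Suc k) - f k)\<bar> \<le> pois t m"
proof -
  define m where "m = nat \<lfloor>t\<rfloor>"
  have m: "real m \<le> t" "t < real m + 1" using assms unfolding m_def by (simp, linarith)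
  have up: "pois t k \<le> pois t (Suc k)" if "k < m" for k
  proof -
    have "pois t k * 1 \<le> pois t k * (t / real (Suc k))"
      using m that pois_pos[OF assms(1)] by (intro mult_left_mono) (auto simp: field_simps less_imp_le)
    thus ?thesis by (simp add: pois_Suc' mult.commute)
  qed
  have dn: "pois t (Suc k) \<le> pois t k" if "k \<ge> m" for k
  proof -
    have "pois t k * (t / real (Suc k)) \<le> pois t k * 1"
      using m that pois_pos[OF assms(1)] by (intro mult_left_mono) (auto simp: field_simps less_imp_le)
    thus ?thesis by (simp add: pois_Suc' mult.commute)
  qed
  have le: "pois_exp t (\<lambda>k. g (Suc k) - g k) \<le> pois t m" if g: "\<And>k. g k \<in> {0..1}" for g
  proof -
    have b: "\<bar>g (Suc k) - g k\<bar> \<le> 1" for k using g[of k] g[of "Suc k"] by auto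
    have "(\<lambda>N. \<Sum>k\<le>N. pois t k * (g (Suc k) - g k)) \<longlonglongrightarrow> pois_exp t (\<lambda>k. g (Suc k) - g k)"
      using summable_LIMSEQ'[OF pois_summable[OF b]] by (simp add: pois_exp_def)
    moreover have "(\<Sum>k\<le>N. pois t k * (g (Suc k) - g k)) \<le> pois t m" for N
      using unimodal_weighted_diff_le[of m "pois t" g, OF up dn _ g] pois_nonneg assms by simp
    ultimately show ?thesis by (intro LIMSEQ_le_const2) auto
  qed
  have b: "\<bar>f (Suc k) - f k\<bar> \<le> 1" for k using f[of k] f[of "Suc k"] by auto
  have "pois_exp t (\<lambda>k. (1 - f (Suc k)) - (1 - f k)) = - pois_exp t (\<lambda>k. f (Suc k) - f k)"
    using pois_exp_affine[of "\<lambda>k. f (Suc k) - f k" 1 t "-1" 0, OF b] by simp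
  moreover have "pois_exp t (\<lambda>k. (1 - f (Suc k)) - (1 - f k)) \<le> pois t m"
    using f by (intro le) auto
  ultimately show ?thesis using le[of f, OF f] by (intro exI[of _ m]) (auto simp: abs_le_iff)
qed

section \<open>The Stein equation for the Poisson law\<close>

text \<open>
The solution of the Stein equation \<open>t * g (x + 1) - x * g x = f x - pois_exp t f\<close>. The equation does not
determine the value at 0, which is set to 0.
\<close>

primrec stein :: "real \<Rightarrow> (nat \<Rightarrow> real) \<Rightarrow> nat \<Rightarrow> real" where
  "stein t f 0 = 0"
| "stein t f (Suc x) = (f x - pois_exp t f + real x * stein t f x) / t"

lemma stein_eq: "t > 0 \<Longrightarrow> t * stein t f (Suc x) - real x * stein t f x = f x - pois_exp t f"
  by simp

declare stein.simps(2) [simp del]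

lemma stein_affine:
  assumes "\<And>k. \<bar>f k\<bar> \<le> C"
  shows "stein t (\<lambda>k. a * f k + b) x = a * stein t f x"
proof (induction x)
  case (Suc x)
  have "a * f x + b - (a * pois_exp t f + b) + real x * (a * y) = a * (f x - pois_exp t f + real x * y)" for y
    by (simp add: algebra_simps)
  thus ?case using Suc by (simp add: stein.simps(2) pois_exp_affine[of f C, OF assms])
qed simp

lemma stein_explicit:
  assumes "t > 0"
  shows "t * pois t x * stein t f (Suc x) =
    (\<Sum>y\<le>x. pois t y * f y) - pois_exp t f * (\<Sum>y\<le>x. pois t y)"
proof (induction x)
  case 0
  have "pois t 0 * (t * stein t f (Suc 0)) = pois t 0 * (f 0 - pois_exp t f)"
    using stein_eq[OF assms, of f 0] by simp
  thus ?case by (simp add: algebra_simps)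
next
  case (Suc x)
  have "t * pois t (Suc x) * stein t f (Suc (Suc x))
     = pois t (Suc x) * (f (Suc x) - pois_exp t f) + (real (Suc x) * pois t (Suc x)) * stein t f (Suc x)"
  proof -
    have "t * stein t f (Suc (Suc x)) = f (Suc x) - pois_exp t f + real (Suc x) * stein t f (Suc x)"
      using stein_eq[OF assms, of f "Suc x"] by simp
    hence "pois t (Suc x) * (t * stein t f (Suc (Suc x)))
        = pois t (Suc x) * (f (Suc x) - pois_exp t f + real (Suc x) * stein t f (Suc x))" by simp
    thus ?thesis by (simp only: distrib_left mult_ac)
  qed
  also have "(real (Suc x) * pois t (Suc x)) * stein t f (Suc x) =
      (\<Sum>y\<le>x. pois t y * f y) - pois_exp t f * (\<Sum>y\<le>x. pois t y)"
    unfolding pois_Suc by (rule Suc.IH)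
  finally show ?case by (simp add: algebra_simps)
qed

text \<open>
The Poisson probability of the numbers strictly greater than \<open>x\<close>.
\<close>

definition pois_tail :: "real \<Rightarrow> nat \<Rightarrow> real" where
  "pois_tail t x = (\<Sum>k. pois t (k + Suc x))"

lemma pois_summable_shift: "summable (\<lambda>k. pois t (k + m))"
  using pois_sums[of t] summable_ignore_initial_segment[of "pois t" m] by (simp add: sums_iff)

lemma pois_tail_eq: "(\<Sum>y\<le>x. pois t y) = 1 - pois_tail t x"
  using suminf_minus_initial_segment[of "pois t" "Suc x"] pois_sums[of t]
  by (simp add: pois_tail_def sums_iff lessThan_Suc_atMost)

lemma pois_tail_ratio_antimono:
  assumes "t > 0"
  shows "pois_tail t (Suc x) / pois t (Suc x) \<le> pois_tail t x / pois t x"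
proof -
  have "pois_tail t (Suc x) \<le> t / real (Suc x) * pois_tail t x"
    unfolding pois_tail_def suminf_mult[OF pois_summable_shift, symmetric]
  proof (rule suminf_le)
    fix k
    have "pois t (k + Suc (Suc x)) = t / real (Suc (k + Suc x)) * pois t (k + Suc x)"
      using pois_Suc'[of t "k + Suc x"] by simp
    also have "\<dots> \<le> t / real (Suc x) * pois t (k + Suc x)"
      using assms pois_nonneg[of t] by (intro mult_right_mono divide_left_mono) auto
    finally show "pois t (k + Suc (Suc x)) \<le> t / real (Suc x) * pois t (k + Suc x)" .
  qed (use pois_summable_shift in \<open>auto intro!: summable_mult simp del: add_Suc_right\<close>)
  hence "pois_tail t (Suc x) / pois t (Suc x) \<le> t / real (Suc x) * pois_tail t x / pois t (Suc x)"
    using pois_pos[OF assms] by (intro divide_right_mono) (auto intro: less_imp_le)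
  also have "\<dots> = pois_tail t x / pois t x"
    using assms pois_pos[OF assms, of x] by (simp add: pois_Suc' del: of_nat_Suc)
  finally show ?thesis .
qed

lemma pois_cdf_ratio_mono:
  assumes "t > 0"
  shows "(\<Sum>y\<le>x. pois t y) / pois t x \<le> (\<Sum>y\<le>Suc x. pois t y) / pois t (Suc x)"
proof -
  define L where "L = (\<lambda>x. (\<Sum>y\<le>x. pois t y) / pois t x)"
  have rec: "L (Suc x) = 1 + real (Suc x) / t * L x" for x
  proof -
    have "(\<Sum>y\<le>x. pois t y) / (t / real (Suc x) * pois t x)
        = real (Suc x) / t * ((\<Sum>y\<le>x. pois t y) / pois t x)"
      using assms by (simp del: of_nat_Suc)
    moreover have "L (Suc x) = 1 + (\<Sum>y\<le>x. pois t y) / pois t (Suc x)"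
      using pois_pos[OF assms, of "Suc x"] by (simp add: L_def add_divide_distrib)
    ultimately show ?thesis unfolding L_def by (simp only: pois_Suc')
  qed
  have L0: "L x \<ge> 0" for x
    unfolding L_def using pois_nonneg[of t] assms by (intro divide_nonneg_nonneg sum_nonneg) auto
  have "L x \<le> L (Suc x)"
  proof (induction x)
    case 0 show ?case unfolding rec using L0[of 0] assms pois_pos[OF assms, of 0] by (simp add: L_def)
  next
    case (Suc x)
    have "real (Suc x) / t * L x \<le> real (Suc (Suc x)) / t * L (Suc x)"
      using Suc L0 assms by (intro mult_mono divide_right_mono) auto
    thus ?case by (subst (1 2) rec) simp
  qed
  thus ?thesis by (simp add: L_def)
qed

text \<open>
The explicit solution at \<open>x + 1\<close> is the sum over \<open>y\<close> of \<open>pois t y * f y\<close> with the factor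
\<open>pois_tail t x / (t * pois t x)\<close> for \<open>y \<le> x\<close> and minus the ratio of the distribution function to
\<open>t * pois t x\<close> for \<open>y > x\<close>. As \<open>x\<close> grows the first factor decreases and the second ratio increases,
hence in the increment from \<open>x + 1\<close> to \<open>x + 2\<close> only the point \<open>y = x + 1\<close> contributes positively.
\<close>

lemma stein_diff_upper:
  assumes t: "t > 0" and f: "\<And>k. f k \<in> {0..1}"
  shows "stein t f (Suc (Suc x)) - stein t f (Suc x) \<le> (1 - exp (- t)) / t"
proof -
  \<comment> \<open>\<open>a x\<close> and \<open>b x\<close> are the parts of the expectation of \<open>f\<close> up to \<open>x\<close> and beyond \<open>x\<close>.\<close>
  define F where "F = (\<lambda>x. \<Sum>y\<le>x. pois t y)"
  define T where "T = pois_tail t"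
  define a where "a = (\<lambda>x. \<Sum>y\<le>x. pois t y * f y)"
  define b where "b = (\<lambda>x. pois_exp t f - a x)"
  let ?q = "pois t (Suc x)"
  have fb: "\<bar>f k\<bar> \<le> 1" for k using f[of k] by auto
  have q: "pois t y > 0" for y by (rule pois_pos[OF t])
  have F: "F x = 1 - T x" for x by (simp add: F_def T_def pois_tail_eq)
  have S: "t * stein t f (Suc x) = a x * (T x / pois t x) - b x * (F x / pois t x)" for x
  proof -
    have "t * stein t f (Suc x) * pois t x = a x * T x - b x * F x"
    proof -
      have "t * stein t f (Suc x) * pois t x = t * pois t x * stein t f (Suc x)" by simp
      also have "\<dots> = a x - pois_exp t f * (1 - T x)"
        unfolding stein_explicit[OF t] pois_tail_eq by (simp add: a_def T_def)
      also have "\<dots> = a x * T x - b x * F x" unfolding F b_def by (simp add: algebra_simps)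
      finally show ?thesis .
    qed
    thus ?thesis using q[of x] by (simp add: field_simps)
  qed
  have a0: "a x \<ge> 0" for x
    unfolding a_def using f less_imp_le[OF q] by (intro sum_nonneg mult_nonneg_nonneg) auto
  have b0: "b x \<ge> 0" for x
  proof -
    have "a x \<le> (\<Sum>k. pois t k * f k)"
      unfolding a_def using f less_imp_le[OF q]
      by (intro sum_le_suminf pois_summable[OF fb] mult_nonneg_nonneg) auto
    thus ?thesis by (simp add: b_def pois_exp_def)
  qed
  have M: "a x * (T (Suc x) / ?q) \<le> a x * (T x / pois t x)"
    using pois_tail_ratio_antimono[OF t, of x] a0[of x] by (intro mult_left_mono) (auto simp: T_def)
  have L: "b (Suc x) * (F x / pois t x) \<le> b (Suc x) * (F (Suc x) / ?q)"
    using pois_cdf_ratio_mono[OF t, of x] b0[of "Suc x"] by (intro mult_left_mono) (auto simp: F_def)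
  have aS: "a (Suc x) = a x + ?q * f (Suc x)" and bS: "b x = b (Suc x) + ?q * f (Suc x)"
    by (simp_all add: a_def b_def)
  have F0: "F x \<ge> 0" unfolding F_def using less_imp_le[OF q] by (intro sum_nonneg)
  have T0: "T (Suc x) \<ge> 0"
    unfolding T_def pois_tail_def using less_imp_le[OF q] pois_summable_shift[of t "Suc (Suc x)"]
    by (intro suminf_nonneg) auto
  have "t * (stein t f (Suc (Suc x)) - stein t f (Suc x))
     \<le> (?q * f (Suc x)) * (T (Suc x) / ?q) + (?q * f (Suc x)) * (F x / pois t x)"
  proof -
    have "t * (stein t f (Suc (Suc x)) - stein t f (Suc x)) =
      (a x + ?q * f (Suc x)) * (T (Suc x) / ?q) - b (Suc x) * (F (Suc x) / ?q)
      - (a x * (T x / pois t x) - (b (Suc x) + ?q * f (Suc x)) * (F x / pois t x))"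
      unfolding right_diff_distrib S aS bS by simp
    thus ?thesis using M L unfolding distrib_right by linarith
  qed
  also have "\<dots> = f (Suc x) * (T (Suc x) + F x * (t / real (Suc x)))"
    using q[of "Suc x"] q[of x] t by (simp add: pois_Suc' distrib_left del: of_nat_Suc)
  also have "\<dots> \<le> 1 * (T (Suc x) + F x * (t / real (Suc x)))"
    using f[of "Suc x"] T0 F0 t by (intro mult_right_mono add_nonneg_nonneg mult_nonneg_nonneg) auto
  also have "\<dots> \<le> 1 - exp (- t)"
  proof -
    have "F x * (t / real (Suc x)) = (\<Sum>i\<le>x. t / real (Suc x) * pois t i)"
      unfolding F_def sum_distrib_left[symmetric] by (rule mult.commute)
    also have "\<dots> \<le> (\<Sum>i\<le>x. t / real (Suc i) * pois t i)"
      using t less_imp_le[OF q] by (intro sum_mono mult_right_mono divide_left_mono) auto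
    also have "\<dots> = (\<Sum>i\<le>x. pois t (Suc i))" by (simp add: pois_Suc')
    also have "\<dots> = F (Suc x) - pois t 0"
      by (simp add: F_def sum.atMost_Suc_shift del: sum.atMost_Suc)
    finally show ?thesis using F[of "Suc x"] by (simp add: pois_def)
  qed
  finally show ?thesis using t by (simp add: field_simps)
qed

text \<open>
The lower bound is the upper bound for \<open>1 - f\<close>, whose Stein solution is the negative of that for \<open>f\<close>.
\<close>

lemma stein_diff_bound:
  assumes t: "t > 0" and f: "\<And>k. f k \<in> {0..1}"
  shows "\<bar>stein t f (Suc (Suc x)) - stein t f (Suc x)\<bar> \<le> (1 - exp (- t)) / t"
proof -
  have fb: "\<bar>f k\<bar> \<le> 1" for k using f[of k] by auto
  define g where "g = (\<lambda>k. - 1 * f k + 1)"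
  have neg: "stein t g y = - stein t f y" for y
    unfolding g_def by (subst stein_affine[of f 1, OF fb]) simp
  have "stein t g (Suc (Suc x)) - stein t g (Suc x) \<le> (1 - exp (- t)) / t"
    using f by (intro stein_diff_upper[OF t]) (auto simp: g_def)
  thus ?thesis using stein_diff_upper[of t f x, OF t f] unfolding neg by linarith
qed

section \<open>The size of the Stein solution\<close>

text \<open>
The expectation of \<open>f (Z + B)\<close> for independent \<open>Z\<close> and \<open>B\<close>, where \<open>Z\<close> is Poisson with mean \<open>t * u\<close>
and \<open>B\<close> is binomial with \<open>x\<close> trials of success probability \<open>1 - u\<close>. For \<open>0 \<le> u < 1\<close> this refers
to the law at time \<open>- ln (1 - u)\<close> of the immigration-death process with equilibrium Poisson mean \<open>t\<close>, started at \<open>x\<close>; the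
recursion over \<open>x\<close> decides one binomial trial after the other.
\<close>

primrec thinned_exp :: "real \<Rightarrow> nat \<Rightarrow> (nat \<Rightarrow> real) \<Rightarrow> real \<Rightarrow> real" where
  "thinned_exp t 0 = (\<lambda>f u. pois_exp (t * u) f)"
| "thinned_exp t (Suc x) = (\<lambda>f u. (1 - u) * thinned_exp t x (\<lambda>k. f (Suc k)) u + u * thinned_exp t x f u)"

lemma thinned_exp_diff:
  assumes "\<And>k. \<bar>f k\<bar> \<le> C" "\<And>k. \<bar>g k\<bar> \<le> D"
  shows "thinned_exp t x (\<lambda>k. f k - g k) u = thinned_exp t x f u - thinned_exp t x g u"
  using assms
proof (induction x arbitrary: f g)
  case 0
  show ?case unfolding thinned_exp.simps by (rule pois_exp_diff) (fact 0)+
next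
  case (Suc x)
  have "thinned_exp t x (\<lambda>k. f k - g k) u = thinned_exp t x f u - thinned_exp t x g u"
    by (rule Suc.IH) (fact Suc.prems)+
  moreover have "thinned_exp t x (\<lambda>k. f (Suc k) - g (Suc k)) u
      = thinned_exp t x (\<lambda>k. f (Suc k)) u - thinned_exp t x (\<lambda>k. g (Suc k)) u"
    by (rule Suc.IH) (fact Suc.prems)+
  ultimately show ?case by (simp only: thinned_exp.simps) (simp add: right_diff_distrib)
qed

lemma thinned_exp_0: "thinned_exp t x f 0 = f x"
proof (induction x arbitrary: f)
  case 0
  have "(\<lambda>k. pois 0 k * f k) sums (\<Sum>k\<in>{0}. pois 0 k * f k)"
    by (rule sums_finite) (auto simp: pois_def)
  thus ?case by (simp add: pois_exp_def sums_iff pois_def)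
qed simp

lemma thinned_exp_1: "thinned_exp t x f 1 = pois_exp t f"
  by (induction x arbitrary: f) simp_all

text \<open>
For \<open>x = 0\<close> the truncated \<open>x - 1\<close> is harmless because of the factor \<open>real x\<close>.
\<close>

lemma thinned_exp_has_derivative:
  assumes "\<And>k. \<bar>f k\<bar> \<le> C"
  shows "((\<lambda>u. thinned_exp t x f u) has_real_derivative
    (t * thinned_exp t x (\<lambda>k. f (Suc k) - f k) u
      - real x * thinned_exp t (x - 1) (\<lambda>k. f (Suc k) - f k) u)) (at u)"
  using assms
proof (induction x arbitrary: f)
  case 0
  have "((\<lambda>u. pois_exp (t * u) f) has_real_derivative pois_exp (t * u) (\<lambda>k. f (Suc k) - f k) * t) (at u)"
    by (rule DERIV_chain'[OF _ pois_exp_has_derivative[OF 0]]) (auto intro!: derivative_eq_intros)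
  thus ?case by (simp add: mult.commute)
next
  case (Suc x)
  let ?S = "\<lambda>f k. f (Suc k) :: real"
  let ?D = "\<lambda>f k. f (Suc k) - f k :: real"
  let ?P = "\<lambda>x f. thinned_exp t x f u"
  have b: "\<bar>?S f k\<bar> \<le> C" for k by (rule Suc.prems)
  have split: "real x * ((1 - u) * ?P (x - 1) (?D (?S f)) + u * ?P (x - 1) (?D f)) = real x * ?P x (?D f)"
    by (cases x) auto
  have "((\<lambda>u. (1 - u) * thinned_exp t x (?S f) u + u * thinned_exp t x f u) has_real_derivative
    (- 1 * ?P x (?S f) + (t * ?P x (?D (?S f)) - real x * ?P (x - 1) (?D (?S f))) * (1 - u)
    + (1 * ?P x f + (t * ?P x (?D f) - real x * ?P (x - 1) (?D f)) * u))) (at u)"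
    by (intro DERIV_add DERIV_mult Suc.IH b Suc.prems) (auto intro!: derivative_eq_intros)
  also have "- 1 * ?P x (?S f) + (t * ?P x (?D (?S f)) - real x * ?P (x - 1) (?D (?S f))) * (1 - u)
    + (1 * ?P x f + (t * ?P x (?D f) - real x * ?P (x - 1) (?D f)) * u)
    = t * ?P (Suc x) (?D f) - (?P x (?S f) - ?P x f)
      - real x * ((1 - u) * ?P (x - 1) (?D (?S f)) + u * ?P (x - 1) (?D f))"
    by (simp add: algebra_simps)
  also have "?P x (?S f) - ?P x f = ?P x (?D f)"
    by (rule thinned_exp_diff[OF b Suc.prems, symmetric])
  also have "t * ?P (Suc x) (?D f) - ?P x (?D f) -
      real x * ((1 - u) * ?P (x - 1) (?D (?S f)) + u * ?P (x - 1) (?D f))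
      = t * ?P (Suc x) (?D f) - real (Suc x) * ?P (Suc x - 1) (?D f)"
    unfolding split by (simp add: algebra_simps)
  finally show ?case by (simp add: fun_eq_iff)
qed

lemma thinned_exp_continuous:
  assumes "\<And>k. \<bar>f k\<bar> \<le> C"
  shows "continuous_on A (thinned_exp t x f)"
  by (intro continuous_at_imp_continuous_on ballI DERIV_isCont[OF thinned_exp_has_derivative[OF assms]])

lemma diff_abs_le_1:
  fixes f :: "nat \<Rightarrow> real"
  assumes "\<And>k. f k \<in> {0..1}"
  shows "\<bar>f (Suc k) - f k\<bar> \<le> 1"
  using assms[of k] assms[of "Suc k"] by auto

text \<open>
Integrating the derivative from \<open>u = 0\<close>, where the law is the unit mass at \<open>x\<close>, to \<open>u = 1\<close>, where it
is the Poisson law, shows that the negative integrals satisfy the recursion that defines the Stein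
solution.
\<close>

lemma stein_integral:
  assumes t: "t > 0" and f: "\<And>k. f k \<in> {0..1}"
  shows "stein t f (Suc x) = - integral {0..1} (thinned_exp t x (\<lambda>k. f (Suc k) - f k))"
proof -
  let ?D = "\<lambda>k. f (Suc k) - f k"
  have fb: "\<bar>f k\<bar> \<le> 1" for k using f[of k] by auto
  note b = diff_abs_le_1[of f, OF f]
  define I where "I = (\<lambda>x. integral {0..1} (thinned_exp t x ?D))"
  have hI: "(thinned_exp t x ?D has_integral I x) {0..1}" for x
    unfolding I_def
    by (intro integrable_integral integrable_continuous_interval thinned_exp_continuous[OF b])
  have rec: "t * I x - real x * I (x - 1) = pois_exp t f - f x" for x
  proof -
    have "((\<lambda>u. t * thinned_exp t x ?D u - real x * thinned_exp t (x - 1) ?D u) has_integral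
        (thinned_exp t x f 1 - thinned_exp t x f 0)) {0..1}"
      by (rule fundamental_theorem_of_calculus)
         (auto simp flip: has_real_derivative_iff_has_vector_derivative
           intro!: has_field_derivative_at_within thinned_exp_has_derivative[of f 1, OF fb, unfolded One_nat_def])
    moreover have "((\<lambda>u. t * thinned_exp t x ?D u - real x * thinned_exp t (x - 1) ?D u) has_integral
        (t * I x - real x * I (x - 1))) {0..1}"
      by (intro has_integral_diff has_integral_mult_right hI)
    ultimately show ?thesis
      by (auto dest: has_integral_unique simp: thinned_exp_0 thinned_exp_1)
  qed
  have "stein t f (Suc x) = - I x"
  proof (induction x)
    case 0
    have "t * stein t f (Suc 0) = t * - I 0" using rec[of 0] stein_eq[OF t, of f 0] by simp
    thus ?case using t by (metis mult_cancel_left less_irrefl)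
  next
    case (Suc x)
    have "t * stein t f (Suc (Suc x)) = t * - I (Suc x)"
      using stein_eq[OF t, of f "Suc x"] rec[of "Suc x"] unfolding Suc.IH by simp
    thus ?case using t by (metis mult_cancel_left less_irrefl)
  qed
  thus ?thesis by (simp add: I_def)
qed

text \<open>
Conditioning on the binomial part only shifts \<open>f\<close>, so the Poisson case suffices.
\<close>

lemma thinned_exp_diff_bound:
  assumes t: "t > 0" and u: "0 < u" "u \<le> 1" and "\<And>k. f k \<in> {0..1}"
  shows "\<bar>thinned_exp t x (\<lambda>k. f (Suc k) - f k) u\<bar> \<le> min 1 (1 / sqrt (2 * exp 1 * (t * u)))"
  using assms(4)
proof (induction x arbitrary: f)
  case 0
  have tu: "t * u > 0" using t u by simp
  from pois_exp_diff_le_mode[of "t * u" f, OF tu 0] obtain m where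
    m: "\<bar>pois_exp (t * u) (\<lambda>k. f (Suc k) - f k)\<bar> \<le> pois (t * u) m" by blast
  have "pois (t * u) m \<le> 1"
    using sum_le_suminf[of "pois (t * u)" "{m}"] pois_sums[of "t * u"] pois_nonneg[of "t * u"] tu
    by (auto simp: sums_iff)
  with m pois_sqrt_le[OF tu, of m] show ?case by simp
next
  case (Suc x)
  let ?D = "\<lambda>f k. f (Suc k) - f k :: real" and ?B = "min 1 (1 / sqrt (2 * exp 1 * (t * u)))"
  have 1: "\<bar>thinned_exp t x (?D f) u\<bar> \<le> ?B" by (rule Suc.IH) (rule Suc.prems)
  have 2: "\<bar>thinned_exp t x (?D (\<lambda>k. f (Suc k))) u\<bar> \<le> ?B" by (rule Suc.IH) (rule Suc.prems)
  have "\<bar>thinned_exp t (Suc x) (?D f) u\<bar>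
     \<le> (1 - u) * \<bar>thinned_exp t x (?D (\<lambda>k. f (Suc k))) u\<bar> + u * \<bar>thinned_exp t x (?D f) u\<bar>"
    using u by (auto intro!: order_trans[OF abs_triangle_ineq] simp: abs_mult)
  also have "\<dots> \<le> (1 - u) * ?B + u * ?B"
    using u 1 2 by (intro add_mono mult_left_mono) auto
  finally show ?case by (simp add: algebra_simps)
qed

lemma stein_bound:
  assumes t: "t > 0" and f: "\<And>k. f k \<in> {0..1}"
  shows "\<bar>stein t f (Suc x)\<bar> \<le> min 1 (sqrt (2 / (t * exp 1)))"
proof -
  let ?h = "thinned_exp t x (\<lambda>k. f (Suc k) - f k)"
  note b = diff_abs_le_1[of f, OF f]
  have hI: "(?h has_integral integral {0..1} ?h) {0..1}"
    by (intro integrable_integral integrable_continuous_interval thinned_exp_continuous[OF b])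
  \<comment> \<open>The bound for the integrand is available for \<open>u > 0\<close> only.\<close>
  have hI0: "((\<lambda>u. if u = 0 then 0 else ?h u) has_integral integral {0..1} ?h) {0..1}"
    by (rule has_integral_spike_finite[OF _ _ hI, of "{0}"]) auto
  have le: "\<bar>integral {0..1} ?h\<bar> \<le> B"
    if g: "(g has_integral B) {0..1}" and g0: "g 0 \<ge> 0"
      and bd: "\<And>u. 0 < u \<Longrightarrow> u \<le> 1 \<Longrightarrow> \<bar>?h u\<bar> \<le> g u" for g B
  proof -
    have "integral {0..1} ?h \<le> B"
      by (rule has_integral_le[OF hI0 g]) (use g0 bd in \<open>force simp: abs_le_iff\<close>)
    moreover have "- integral {0..1} ?h \<le> B"
      by (rule has_integral_le[OF has_integral_neg[OF hI0] g]) (use g0 bd in \<open>force simp: abs_le_iff\<close>)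
    ultimately show ?thesis by (simp add: abs_le_iff)
  qed
  have bd: "\<bar>?h u\<bar> \<le> 1" "\<bar>?h u\<bar> \<le> 1 / sqrt (2 * exp 1 * (t * u))" if "0 < u" "u \<le> 1" for u
    using thinned_exp_diff_bound[of t u f x] that t f by auto
  have "\<bar>integral {0..1} ?h\<bar> \<le> 1"
    using has_integral_const_real[of "1::real" 0 1] bd(1) by (intro le[of "\<lambda>_. 1"]) auto
  moreover have "\<bar>integral {0..1} ?h\<bar> \<le> sqrt (2 / (t * exp 1))"
  proof (rule le)
    show "((\<lambda>u. 1 / sqrt (2 * exp 1 * t) * u powr (- 1 / 2)) has_integral sqrt (2 / (t * exp 1))) {0..1}"
    proof -
      have "((\<lambda>u. 1 / sqrt (2 * exp 1 * t) * u powr (- 1 / 2)) has_integral 1 / sqrt (2 * exp 1 * t) * 2) {0..1}"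
        using has_integral_powr_from_0[of "- 1 / 2" 1] by (intro has_integral_mult_right) simp
      moreover have "1 / sqrt (2 * exp 1 * t) * 2 = sqrt (2 / (t * exp 1))"
        using t real_sqrt_mult_self[of 2] by (simp add: real_sqrt_mult real_sqrt_divide field_simps)
      ultimately show ?thesis by simp
    qed
    fix u :: real assume u: "0 < u" "u \<le> 1"
    show "\<bar>?h u\<bar> \<le> 1 / sqrt (2 * exp 1 * t) * u powr (- 1 / 2)"
      using bd(2)[OF u] u by (simp add: powr_minus powr_half_sqrt real_sqrt_mult field_simps)
  qed simp
  ultimately show ?thesis unfolding stein_integral[OF t f] by simp
qed

section \<open>Expectations over random diagonals\<close>

text \<open>
The expectation of \<open>f\<close> at a sum of independent Bernoulli variables, indexed by the finite set \<open>J\<close>, with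
success probabilities \<open>q j\<close>; \<open>B\<close> is the set of indices of the successes.
\<close>

definition bern_exp :: "nat set \<Rightarrow> (nat \<Rightarrow> real) \<Rightarrow> (nat \<Rightarrow> real) \<Rightarrow> real" where
  "bern_exp J q f = (\<Sum>B\<in>Pow J. (\<Prod>j\<in>B. q j) * (\<Prod>j\<in>J - B. 1 - q j) * f (card B))"

text \<open>
The bijections from \<open>J\<close> to \<open>R\<close>, made unique as functions by the value \<open>undefined\<close> outside \<open>J\<close>.
\<close>

definition bijections :: "nat set \<Rightarrow> nat set \<Rightarrow> (nat \<Rightarrow> nat) set" where
  "bijections J R = {\<sigma> \<in> J \<rightarrow>\<^sub>E R. bij_betw \<sigma> J R}"

text \<open>
The expectation of \<open>f\<close> at the random diagonal sum of the submatrix of \<open>p\<close> with rows \<open>J\<close> and columns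
\<open>R\<close>, where \<open>J\<close> and \<open>R\<close> have the same finite cardinality, the number of bijections then being the
factorial of that cardinality.
\<close>

definition diag_exp :: "(nat \<Rightarrow> nat \<Rightarrow> real) \<Rightarrow> nat set \<Rightarrow> nat set \<Rightarrow> (nat \<Rightarrow> real) \<Rightarrow> real" where
  "diag_exp p J R f = (\<Sum>\<sigma>\<in>bijections J R. bern_exp J (\<lambda>j. p j (\<sigma> j)) f) / fact (card J)"

abbreviation fdiff :: "(nat \<Rightarrow> real) \<Rightarrow> nat \<Rightarrow> real" where
  "fdiff f \<equiv> (\<lambda>x. f (Suc x) - f x)"

abbreviation fshift :: "(nat \<Rightarrow> real) \<Rightarrow> nat \<Rightarrow> real" where
  "fshift f \<equiv> (\<lambda>x. f (Suc x))"

lemma bern_exp_empty [simp]: "bern_exp {} q f = f 0"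
  by (simp add: bern_exp_def)

lemma bern_exp_insert:
  assumes "finite J" "j \<notin> J"
  shows "bern_exp (insert j J) q f = bern_exp J q (\<lambda>x. f x + q j * (f (Suc x) - f x))"
proof -
  let ?w = "\<lambda>J B. (\<Prod>j\<in>B. q j) * (\<Prod>j\<in>J - B. 1 - q j)"
  have inj: "inj_on (insert j) (Pow J)" using assms(2) by (auto simp: inj_on_def)
  have out: "(\<Sum>B\<in>Pow J. ?w (insert j J) B * f (card B)) = (\<Sum>B\<in>Pow J. ?w J B * ((1 - q j) * f (card B)))"
  proof (rule sum.cong, rule refl)
    fix B assume B: "B \<in> Pow J"
    hence "insert j J - B = insert j (J - B)" using assms by auto
    thus "?w (insert j J) B * f (card B) = ?w J B * ((1 - q j) * f (card B))"
      using assms by simp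
  qed
  have "(\<Sum>B\<in>insert j ` Pow J. ?w (insert j J) B * f (card B)) = (\<Sum>B\<in>Pow J. ?w J B * (q j * f (Suc (card B))))"
    unfolding sum.reindex[OF inj] o_def
  proof (rule sum.cong, rule refl)
    fix B assume B: "B \<in> Pow J"
    have fB: "finite B" "j \<notin> B" using B assms finite_subset by auto
    have "insert j J - insert j B = J - B" using assms B by auto
    thus "?w (insert j J) (insert j B) * f (card (insert j B)) = ?w J B * (q j * f (Suc (card B)))"
      using fB by (simp add: card_insert_disjoint)
  qed
  moreover have "Pow (insert j J) = Pow J \<union> insert j ` Pow J" by (rule Pow_insert)
  moreover have "Pow J \<inter> insert j ` Pow J = {}" using assms by auto
  ultimately have "bern_exp (insert j J) q f
     = (\<Sum>B\<in>Pow J. ?w J B * ((1 - q j) * f (card B))) + (\<Sum>B\<in>Pow J. ?w J B * (q j * f (Suc (card B))))"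
    using assms out by (simp add: bern_exp_def sum.union_disjoint)
  thus ?thesis
    by (simp add: bern_exp_def algebra_simps flip: sum.distrib)
qed

lemma bern_exp_cong: "(\<And>j. j \<in> J \<Longrightarrow> q j = q' j) \<Longrightarrow> bern_exp J q f = bern_exp J q' f"
  unfolding bern_exp_def
  by (intro sum.cong arg_cong2[of _ _ _ _ "(*)"] prod.cong refl) auto

lemma finite_bijections [simp]: "finite J \<Longrightarrow> finite R \<Longrightarrow> finite (bijections J R)"
  by (rule finite_subset[of _ "J \<rightarrow>\<^sub>E R"]) (auto simp: bijections_def intro: finite_PiE)

lemma sum_bijections:
  assumes "finite J" "finite R" "j \<in> J"
  shows "(\<Sum>\<sigma>\<in>bijections J R. F \<sigma>) = (\<Sum>r\<in>R. \<Sum>\<tau>\<in>bijections (J - {j}) (R - {r}). F (\<tau>(j := r)))"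
proof -
  have "(\<Sum>r\<in>R. \<Sum>\<tau>\<in>bijections (J - {j}) (R - {r}). F (\<tau>(j := r)))
     = (\<Sum>(r, \<tau>)\<in>Sigma R (\<lambda>r. bijections (J - {j}) (R - {r})). F (\<tau>(j := r)))"
    using assms by (intro sum.Sigma) auto
  also have "\<dots> = (\<Sum>\<sigma>\<in>bijections J R. F \<sigma>)"
  proof (rule sum.reindex_bij_witness[where j = "\<lambda>(r, \<tau>). \<tau>(j := r)"
        and i = "\<lambda>\<sigma>. (\<sigma> j, restrict \<sigma> (J - {j}))"], goal_cases)
    case (1 x)
    thus ?case using assms by (auto simp: bijections_def fun_eq_iff PiE_def extensional_def)
  next
    case (2 x)
    obtain r \<tau> where x: "x = (r, \<tau>)" by (cases x)
    have "bij_betw (\<tau>(j := r)) (insert j (J - {j})) (insert r (R - {r}))"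
    proof -
      have "bij_betw \<tau> (J - {j}) (R - {r})" using 2 x by (auto simp: bijections_def)
      hence "bij_betw (\<tau>(j := r)) (J - {j}) (R - {r})"
        by (rule bij_betw_cong[THEN iffD2, rotated]) auto
      hence "bij_betw (\<tau>(j := r)) (J - {j} \<union> {j}) (R - {r} \<union> {(\<tau>(j := r)) j})"
        by (intro notIn_Un_bij_betw) auto
      thus ?thesis by (simp only: fun_upd_same Un_insert_right Un_empty_right)
    qed
    thus ?case using 2 x assms by (auto simp: bijections_def insert_absorb PiE_def extensional_def)
  next
    case (3 \<sigma>)
    thus ?case using assms by (auto simp: bijections_def fun_eq_iff PiE_def extensional_def)
  next
    case (4 \<sigma>)
    hence s: "bij_betw \<sigma> J R" "\<sigma> \<in> J \<rightarrow>\<^sub>E R" by (auto simp: bijections_def)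
    have "bij_betw \<sigma> (J - {j}) (R - {\<sigma> j})"
      using bij_betw_DiffI[OF s(1), of "{j}" "{\<sigma> j}"] s(1) assms(3) by (auto dest: bij_betwE)
    hence "bij_betw (restrict \<sigma> (J - {j})) (J - {j}) (R - {\<sigma> j})" by simp
    thus ?case using s assms by (auto simp: bijections_def dest: bij_betwE)
  qed auto
  finally show ?thesis ..
qed

text \<open>
Adding an independent Bernoulli variable with success probability \<open>q\<close> to the argument of \<open>f\<close> amounts
to replacing \<open>f x\<close> by \<open>f x + q * (f (x + 1) - f x)\<close>. This is the analogue of the Laplace expansion of a
permanent; together with linearity it yields the bounds and identities below.
\<close>

lemma diag_exp_row:
  assumes "finite J" "finite R" "j \<in> J"
  shows "diag_exp p J R f =
    (\<Sum>r\<in>R. diag_exp p (J - {j}) (R - {r}) (\<lambda>x. f x + p j r * (f (Suc x) - f x))) / real (card J)"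
proof -
  have J: "J = insert j (J - {j})" using assms by auto
  have c: "card J = Suc (card (J - {j}))" using card_Suc_Diff1[OF assms(1,3)] by (rule sym)
  have "bern_exp J (\<lambda>k. p k ((\<tau>(j := r)) k)) f =
      bern_exp (J - {j}) (\<lambda>k. p k (\<tau> k)) (\<lambda>x. f x + p j r * (f (Suc x) - f x))" for r \<tau>
  proof -
    have "bern_exp J (\<lambda>k. p k ((\<tau>(j := r)) k)) f = 
      bern_exp (J - {j}) (\<lambda>k. p k ((\<tau>(j := r)) k)) (\<lambda>x. f x + p j r * (f (Suc x) - f x))"
      using assms by (subst J, subst bern_exp_insert) auto
    also have "\<dots> = bern_exp (J - {j}) (\<lambda>k. p k (\<tau> k)) (\<lambda>x. f x + p j r * (f (Suc x) - f x))"
      by (rule bern_exp_cong) auto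
    finally show ?thesis .
  qed
  thus ?thesis unfolding diag_exp_def sum_bijections[OF assms] c
    by (simp add: sum_divide_distrib mult.commute del: of_nat_Suc)
qed

lemma diag_exp_empty [simp]: "diag_exp p {} {} f = f 0"
  by (simp add: diag_exp_def bijections_def bij_betw_def)

lemma diag_exp_add: "diag_exp p J R (\<lambda>x. f x + g x) = diag_exp p J R f + diag_exp p J R g"
  by (simp add: diag_exp_def bern_exp_def algebra_simps sum.distrib add_divide_distrib)

lemma diag_exp_cmult: "diag_exp p J R (\<lambda>x. c * f x) = c * diag_exp p J R f"
  by (simp add: diag_exp_def bern_exp_def sum_distrib_left mult_ac)

lemma diag_exp_diff: "diag_exp p J R (\<lambda>x. f x - g x) = diag_exp p J R f - diag_exp p J R g"
  using diag_exp_add[of p J R f "\<lambda>x. - 1 * g x"] unfolding diag_exp_cmult by simp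

lemma diag_exp_row':
  assumes "finite J" "finite R" "j \<in> J"
  shows "diag_exp p J R f =
    (\<Sum>r\<in>R. diag_exp p (J - {j}) (R - {r}) f + p j r * diag_exp p (J - {j}) (R - {r}) (fdiff f))
      / real (card J)"
  by (simp add: diag_exp_row[OF assms] diag_exp_add diag_exp_cmult)

lemma diag_exp_bound:
  assumes "finite J" "finite R" "card J = card R"
    and p: "\<And>j r. j \<in> J \<Longrightarrow> r \<in> R \<Longrightarrow> p j r \<in> {0..1}" and f: "\<And>x. \<bar>f x\<bar> \<le> C"
  shows "\<bar>diag_exp p J R f\<bar> \<le> C"
  using assms
proof (induction "card J" arbitrary: J R f)
  case 0
  hence "J = {}" "R = {}" by auto
  thus ?case using 0 by simp
next
  case (Suc m)
  then obtain j where j: "j \<in> J" by fastforce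
  have "\<bar>diag_exp p (J - {j}) (R - {r}) (\<lambda>x. f x + p j r * (f (Suc x) - f x))\<bar> \<le> C" if r: "r \<in> R" for r
  proof (rule Suc.hyps(1))
    fix x
    have "\<bar>(1 - p j r) * f x + p j r * f (Suc x)\<bar> \<le> (1 - p j r) * \<bar>f x\<bar> + p j r * \<bar>f (Suc x)\<bar>"
      using Suc.prems(4)[OF j r] by (auto intro!: order_trans[OF abs_triangle_ineq] simp: abs_mult)
    also have "\<dots> \<le> (1 - p j r) * C + p j r * C"
      using Suc.prems(4)[OF j r] Suc.prems(5) by (intro add_mono mult_left_mono) auto
    finally show "\<bar>f x + p j r * (f (Suc x) - f x)\<bar> \<le> C" by (simp add: algebra_simps)
  qed (use Suc.hyps(2) Suc.prems j r in auto)
  hence "\<bar>\<Sum>r\<in>R. diag_exp p (J - {j}) (R - {r}) (\<lambda>x. f x + p j r * (f (Suc x) - f x))\<bar> \<le> real (card R) * C"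
    by (intro order_trans[OF sum_abs] sum_bounded_above) auto
  thus ?case using Suc.hyps(2) Suc.prems
    unfolding diag_exp_row[OF Suc.prems(1,2) j] by (simp add: field_simps del: of_nat_Suc)
qed

lemma diag_exp_const:
  assumes "finite J" "finite R" "card J = card R"
  shows "diag_exp p J R (\<lambda>_. c) = c"
  using assms
proof (induction "card J" arbitrary: J R)
  case 0
  hence "J = {}" "R = {}" by auto
  thus ?case by simp
next
  case (Suc m)
  then obtain j where j: "j \<in> J" by fastforce
  have "diag_exp p (J - {j}) (R - {r}) (\<lambda>_. c) = c" if "r \<in> R" for r
    by (rule Suc.hyps(1)) (use Suc.hyps(2) Suc.prems j that in auto)
  moreover have "R \<noteq> {}" using Suc.hyps(2) Suc.prems by auto
  ultimately show ?case using Suc.hyps(2) Suc.prems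
    by (subst diag_exp_row[OF Suc.prems(1,2) j]) (simp del: of_nat_Suc)
qed

lemma sum_pairs_swap:
  fixes F :: "nat \<Rightarrow> nat \<Rightarrow> real"
  assumes "finite R"
  shows "(\<Sum>r\<in>R. \<Sum>s\<in>R - {r}. F r s) = (\<Sum>s\<in>R. \<Sum>r\<in>R - {s}. F r s)"
proof -
  have "(\<Sum>r\<in>R. \<Sum>s\<in>R - {r}. F r s) = (\<Sum>r\<in>R. \<Sum>s\<in>R. if r \<noteq> s then F r s else 0)"
    using assms by (intro sum.cong refl sum.mono_neutral_cong_left) auto
  also have "\<dots> = (\<Sum>s\<in>R. \<Sum>r\<in>R. if r \<noteq> s then F r s else 0)" by (rule sum.swap)
  also have "\<dots> = (\<Sum>s\<in>R. \<Sum>r\<in>R - {s}. F r s)"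
    using assms by (intro sum.cong refl sum.mono_neutral_cong_right) auto
  finally show ?thesis .
qed

lemma Diff_Diff_singleton: "A - {a} - {b} = A - {a, b}"
  by auto

text \<open>
By induction: expand along a row \<open>j\<close>, then along column \<open>r\<close> wherever row \<open>j\<close> has not used that column,
and recombine the result by a row expansion of the matrices without column \<open>r\<close>.
\<close>

lemma diag_exp_col:
  assumes "finite J" "finite R" "card J = card R" "r \<in> R"
  shows "diag_exp p J R f =
    (\<Sum>j\<in>J. diag_exp p (J - {j}) (R - {r}) (\<lambda>x. f x + p j r * (f (Suc x) - f x))) / real (card J)"
  using assms
proof (induction "card J" arbitrary: J R f)
  case 0 thus ?case by auto
next
  case (Suc m)
  let ?T = "\<lambda>q f x. f x + q * (f (Suc x) - f x) :: real"
  let ?E = "\<lambda>j k r s. diag_exp p (J - {j, k}) (R - {r, s})"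
  obtain j where j: "j \<in> J" using Suc by fastforce
  have cm: "card (J - {k}) = m" if "k \<in> J" for k using Suc.hyps(2) Suc.prems that by auto
  have m: "real (card J) = real m + 1" using Suc.hyps(2) by simp
  have comm: "?T a (?T b f) = ?T b (?T a f)" for a b by (rule ext) (simp add: algebra_simps)
  have 1: "diag_exp p (J - {j}) (R - {s}) (?T (p j s) f) =
      (\<Sum>k\<in>J - {j}. ?E j k r s (?T (p j s) (?T (p k r) f))) / real m" if s: "s \<in> R - {r}" for s
  proof -
    have "diag_exp p (J - {j}) (R - {s}) (?T (p j s) f) =
      (\<Sum>k\<in>J - {j}. diag_exp p (J - {j} - {k}) (R - {s} - {r}) (?T (p k r) (?T (p j s) f))) / real (card (J - {j}))"
      by (rule Suc.hyps(1)) (use Suc.hyps(2) Suc.prems j s in auto)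
    thus ?thesis unfolding Diff_Diff_singleton cm[OF j] comm[of "p _ r"] insert_commute[of s r] .
  qed
  have 2: "(\<Sum>s\<in>R - {r}. ?E j k r s (?T (p j s) (?T (p k r) f))) / real m
      = diag_exp p (J - {k}) (R - {r}) (?T (p k r) f)" if k: "k \<in> J - {j}" for k
  proof -
    have "diag_exp p (J - {k}) (R - {r}) (?T (p k r) f) =
      (\<Sum>s\<in>R - {r}. diag_exp p (J - {k} - {j}) (R - {r} - {s}) (?T (p j s) (?T (p k r) f))) / real (card (J - {k}))"
      by (rule diag_exp_row) (use Suc.prems j k in auto)
    thus ?thesis using k cm[of k] unfolding Diff_Diff_singleton insert_commute[of k j] by simp
  qed
  have "diag_exp p J R f = (\<Sum>s\<in>R. diag_exp p (J - {j}) (R - {s}) (?T (p j s) f)) / real (card J)"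
    by (rule diag_exp_row) (use Suc.prems j in auto)
  also have "(\<Sum>s\<in>R. diag_exp p (J - {j}) (R - {s}) (?T (p j s) f)) =
      diag_exp p (J - {j}) (R - {r}) (?T (p j r) f)
      + (\<Sum>s\<in>R - {r}. diag_exp p (J - {j}) (R - {s}) (?T (p j s) f))"
    using Suc.prems by (simp add: sum.remove)
  also have "(\<Sum>s\<in>R - {r}. diag_exp p (J - {j}) (R - {s}) (?T (p j s) f)) =
      (\<Sum>s\<in>R - {r}. \<Sum>k\<in>J - {j}. ?E j k r s (?T (p j s) (?T (p k r) f)) / real m)"
    by (intro sum.cong refl) (simp add: 1 sum_divide_distrib)
  also have "\<dots> = (\<Sum>k\<in>J - {j}. \<Sum>s\<in>R - {r}. ?E j k r s (?T (p j s) (?T (p k r) f)) / real m)"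
    by (rule sum.swap)
  also have "\<dots> = (\<Sum>k\<in>J - {j}. diag_exp p (J - {k}) (R - {r}) (?T (p k r) f))"
    by (intro sum.cong refl) (simp add: 2[symmetric] sum_divide_distrib)
  also have "diag_exp p (J - {j}) (R - {r}) (?T (p j r) f) + \<dots> =
     (\<Sum>k\<in>J. diag_exp p (J - {k}) (R - {r}) (?T (p k r) f))"
    using Suc.prems j by (simp add: sum.remove)
  finally show ?case .
qed

lemma diag_exp_col':
  assumes "finite J" "finite R" "card J = card R" "r \<in> R"
  shows "diag_exp p J R f =
    (\<Sum>j\<in>J. diag_exp p (J - {j}) (R - {r}) f + p j r * diag_exp p (J - {j}) (R - {r}) (fdiff f))
      / real (card J)"
  by (simp add: diag_exp_col[OF assms] diag_exp_add diag_exp_cmult)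

text \<open>
The expectation of \<open>S * g S\<close> is the sum over all entries of the probability that the entry lies on the
random diagonal and equals 1, times the expectation of \<open>g (1 + S')\<close>, with \<open>S'\<close> belonging to the matrix
without the row and column of that entry.
\<close>

lemma diag_exp_size_bias:
  assumes "finite J" "finite R" "card J = card R"
  shows "diag_exp p J R (\<lambda>x. real x * g x) =
    (\<Sum>j\<in>J. \<Sum>r\<in>R. p j r * diag_exp p (J - {j}) (R - {r}) (fshift g)) / real (card J)"
  using assms
proof (induction "card J" arbitrary: J R g)
  case 0
  hence "J = {}" "R = {}" by auto
  thus ?case by simp
next
  case (Suc m)
  let ?T = "\<lambda>q f x. f x + q * (f (Suc x) - f x) :: real"
  let ?E = "\<lambda>j k r s. diag_exp p (J - {j, k}) (R - {r, s})"
  obtain j where j: "j \<in> J" using Suc by fastforce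
  have cm: "card (J - {k}) = m" if "k \<in> J" for k using Suc.hyps(2) Suc.prems that by auto
  have T: "?T q (\<lambda>x. real x * g x) = (\<lambda>x. real x * ?T q g x + q * g (Suc x))" for q
    by (rule ext) (simp add: algebra_simps)
  have 1: "diag_exp p (J - {j}) (R - {r}) (?T (p j r) (\<lambda>x. real x * g x)) =
      p j r * diag_exp p (J - {j}) (R - {r}) (fshift g)
      + (\<Sum>k\<in>J - {j}. \<Sum>s\<in>R - {r}. p k s * ?E j k r s (?T (p j r) (fshift g)) / real m)"
    if r: "r \<in> R" for r
  proof -
    have "diag_exp p (J - {j}) (R - {r}) (\<lambda>x. real x * ?T (p j r) g x) =
      (\<Sum>k\<in>J - {j}. \<Sum>s\<in>R - {r}. p k s * diag_exp p (J - {j} - {k}) (R - {r} - {s}) (fshift (?T (p j r) g)))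
        / real (card (J - {j}))"
      by (rule Suc.hyps(1)) (use Suc.hyps(2) Suc.prems j r in auto)
    thus ?thesis unfolding T diag_exp_add diag_exp_cmult Diff_Diff_singleton cm[OF j]
      by (simp add: sum_divide_distrib diag_exp_add diag_exp_cmult)
  qed
  have 2: "(\<Sum>r\<in>R - {s}. ?E j k r s (?T (p j r) (fshift g)) / real m) = diag_exp p (J - {k}) (R - {s}) (fshift g)"
    if k: "k \<in> J - {j}" for k s
  proof -
    have "diag_exp p (J - {k}) (R - {s}) (fshift g) =
      (\<Sum>r\<in>R - {s}. diag_exp p (J - {k} - {j}) (R - {s} - {r}) (?T (p j r) (fshift g))) / real (card (J - {k}))"
      by (rule diag_exp_row) (use Suc.prems j k in auto)
    moreover have "J - {k} - {j} = J - {j, k}" "R - {s} - {r} = R - {r, s}" for r by auto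
    ultimately show ?thesis using k by (simp only: cm[of k] Diff_iff sum_divide_distrib)
  qed
  have "diag_exp p J R (\<lambda>x. real x * g x) =
      (\<Sum>r\<in>R. diag_exp p (J - {j}) (R - {r}) (?T (p j r) (\<lambda>x. real x * g x))) / real (card J)"
    by (rule diag_exp_row) (use Suc.prems j in auto)
  also have "(\<Sum>r\<in>R. diag_exp p (J - {j}) (R - {r}) (?T (p j r) (\<lambda>x. real x * g x))) =
      (\<Sum>r\<in>R. p j r * diag_exp p (J - {j}) (R - {r}) (fshift g))
      + (\<Sum>r\<in>R. \<Sum>k\<in>J - {j}. \<Sum>s\<in>R - {r}. p k s * ?E j k r s (?T (p j r) (fshift g)) / real m)"
    by (simp only: 1 sum.distrib cong: sum.cong)
  also have "(\<Sum>r\<in>R. \<Sum>k\<in>J - {j}. \<Sum>s\<in>R - {r}. p k s * ?E j k r s (?T (p j r) (fshift g)) / real m)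
     = (\<Sum>k\<in>J - {j}. \<Sum>r\<in>R. \<Sum>s\<in>R - {r}. p k s * ?E j k r s (?T (p j r) (fshift g)) / real m)"
    by (rule sum.swap)
  also have "\<dots> = (\<Sum>k\<in>J - {j}. \<Sum>s\<in>R. \<Sum>r\<in>R - {s}. p k s * ?E j k r s (?T (p j r) (fshift g)) / real m)"
    using Suc.prems by (intro sum.cong refl sum_pairs_swap)
  also have "\<dots> = (\<Sum>k\<in>J - {j}. \<Sum>s\<in>R. p k s * (\<Sum>r\<in>R - {s}. ?E j k r s (?T (p j r) (fshift g)) / real m))"
    by (simp add: sum_distrib_left)
  also have "\<dots> = (\<Sum>k\<in>J - {j}. \<Sum>s\<in>R. p k s * diag_exp p (J - {k}) (R - {s}) (fshift g))"
    by (intro sum.cong refl) (simp only: 2)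
  also have "(\<Sum>r\<in>R. p j r * diag_exp p (J - {j}) (R - {r}) (fshift g)) + \<dots> =
     (\<Sum>k\<in>J. \<Sum>s\<in>R. p k s * diag_exp p (J - {k}) (R - {s}) (fshift g))"
    using Suc.prems j by (simp add: sum.remove)
  finally show ?case .
qed

section \<open>The Stein operator of a random diagonal sum\<close>

text \<open>
The mean of the random diagonal sum of the square submatrix of \<open>p\<close> with rows \<open>J\<close> and columns \<open>R\<close>.
\<close>

definition mat_mean :: "(nat \<Rightarrow> nat \<Rightarrow> real) \<Rightarrow> nat set \<Rightarrow> nat set \<Rightarrow> real" where
  "mat_mean p J R = (\<Sum>j\<in>J. \<Sum>r\<in>R. p j r) / real (card J)"

definition row_avg :: "(nat \<Rightarrow> nat \<Rightarrow> real) \<Rightarrow> nat set \<Rightarrow> nat \<Rightarrow> real" where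
  "row_avg p R j = (\<Sum>r\<in>R. p j r) / real (card R)"

text \<open>
The total weight of the single-entry terms in the Stein identity: the sum of the squared row averages.
\<close>

definition row_sq :: "(nat \<Rightarrow> nat \<Rightarrow> real) \<Rightarrow> nat set \<Rightarrow> nat set \<Rightarrow> real" where
  "row_sq p J R = (\<Sum>j\<in>J. (row_avg p R j)\<^sup>2)"

text \<open>
The normalised sum over ordered pairs of distinct rows and ordered pairs of distinct columns. For the
full matrix the normalisation is that of \<open>gam2\<close>, and \<open>pair_dev\<close> below is \<open>gam2\<close> itself.
\<close>

definition pair_sum :: "nat set \<Rightarrow> nat set \<Rightarrow> (nat \<Rightarrow> nat \<Rightarrow> nat \<Rightarrow> nat \<Rightarrow> real) \<Rightarrow> real" where
  "pair_sum J R F = (\<Sum>j\<in>J. \<Sum>k\<in>J - {j}. \<Sum>r\<in>R. \<Sum>s\<in>R - {r}. F j k r s)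
     / (2 * (real (card J))\<^sup>2 * (real (card J) - 1))"

definition pair_dev :: "(nat \<Rightarrow> nat \<Rightarrow> real) \<Rightarrow> nat set \<Rightarrow> nat set \<Rightarrow> real" where
  "pair_dev p J R = pair_sum J R (\<lambda>j k r s. \<bar>p j r - p j s\<bar> * \<bar>p k r - p k s\<bar>)"

lemma pair_sum_mono:
  assumes "\<And>j k r s. j \<in> J \<Longrightarrow> k \<in> J - {j} \<Longrightarrow> r \<in> R \<Longrightarrow> s \<in> R - {r} \<Longrightarrow> F j k r s \<le> G j k r s"
    and "card J \<ge> 1"
  shows "pair_sum J R F \<le> pair_sum J R G"
  unfolding pair_sum_def using assms by (intro divide_right_mono sum_mono) auto

lemma pair_sum_abs:
  assumes "card J \<ge> 1"
  shows "\<bar>pair_sum J R F\<bar> \<le> pair_sum J R (\<lambda>j k r s. \<bar>F j k r s\<bar>)"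
  unfolding pair_sum_def abs_divide using assms
  by (auto intro!: divide_right_mono order_trans[OF sum_abs] sum_mono)

lemma pair_sum_cong:
  assumes "\<And>j k r s. j \<in> J \<Longrightarrow> k \<in> J - {j} \<Longrightarrow> r \<in> R \<Longrightarrow> s \<in> R - {r} \<Longrightarrow> F j k r s = G j k r s"
  shows "pair_sum J R F = pair_sum J R G"
  unfolding pair_sum_def using assms
  by (intro arg_cong2[of _ _ _ _ "(/)"] sum.cong refl) auto

lemma pair_sum_add: "pair_sum J R (\<lambda>j k r s. F j k r s + G j k r s) = pair_sum J R F + pair_sum J R G"
  by (simp add: pair_sum_def sum.distrib add_divide_distrib)

lemma pair_sum_cmult: "pair_sum J R (\<lambda>j k r s. c * F j k r s) = c * pair_sum J R F"
  by (simp add: pair_sum_def sum_distrib_left)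

lemma pair_dev_nonneg: "pair_dev p J R \<ge> 0"
proof (cases "card J = 0")
  case False
  thus ?thesis unfolding pair_dev_def pair_sum_def by (intro divide_nonneg_nonneg sum_nonneg) auto
qed (simp add: pair_dev_def pair_sum_def)

lemma row_sq_nonneg: "row_sq p J R \<ge> 0"
  unfolding row_sq_def by (intro sum_nonneg) auto

lemma row_sq_eq:
  "card J = card R \<Longrightarrow> row_sq p J R = (\<Sum>j\<in>J. \<Sum>r\<in>R. row_avg p R j * p j r) / real (card J)"
  by (simp add: row_sq_def row_avg_def power2_eq_square sum_divide_distrib sum_distrib_left)

lemma row_sq_submatrix:
  assumes "finite J" "J' \<subseteq> J" "finite R" "R' \<subseteq> R" "card R' > 0"
    and p: "\<And>j r. j \<in> J \<Longrightarrow> r \<in> R \<Longrightarrow> p j r \<ge> 0"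
  shows "row_sq p J' R' \<le> (real (card R) / real (card R'))\<^sup>2 * row_sq p J R"
proof -
  have "card R > 0" using assms card_mono[of R R'] by linarith
  have "row_sq p J' R' \<le> (\<Sum>j\<in>J'. (real (card R) / real (card R') * row_avg p R j)\<^sup>2)"
    unfolding row_sq_def
  proof (intro sum_mono power_mono)
    fix j assume j: "j \<in> J'"
    show "0 \<le> row_avg p R' j"
      unfolding row_avg_def using assms j by (intro divide_nonneg_nonneg sum_nonneg p) auto
    have "(\<Sum>r\<in>R'. p j r) \<le> (\<Sum>r\<in>R. p j r)"
      using assms j by (intro sum_mono2 p) auto
    thus "row_avg p R' j \<le> real (card R) / real (card R') * row_avg p R j"
      using \<open>card R > 0\<close> by (simp add: row_avg_def divide_right_mono)
  qed
  also have "\<dots> \<le> (\<Sum>j\<in>J. (real (card R) / real (card R') * row_avg p R j)\<^sup>2)"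
    using assms by (intro sum_mono2) auto
  finally show ?thesis unfolding row_sq_def sum_distrib_left power_mult_distrib .
qed

lemma pair_dev_submatrix:
  assumes "finite J" "J' \<subseteq> J" "finite R" "R' \<subseteq> R" "card J' \<ge> 2"
  shows "pair_dev p J' R' \<le> (real (card J))\<^sup>2 * (real (card J) - 1)
    / ((real (card J'))\<^sup>2 * (real (card J') - 1)) * pair_dev p J R"
proof -
  have c: "card J \<ge> 2" using assms card_mono[of J J'] by linarith
  let ?F = "\<lambda>j k r s. \<bar>p j r - p j s\<bar> * \<bar>p k r - p k s\<bar>"
  have "(\<Sum>j\<in>J'. \<Sum>k\<in>J' - {j}. \<Sum>r\<in>R'. \<Sum>s\<in>R' - {r}. ?F j k r s)
     \<le> (\<Sum>j\<in>J. \<Sum>k\<in>J - {j}. \<Sum>r\<in>R. \<Sum>s\<in>R - {r}. ?F j k r s)" (is "?a \<le> ?b")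
  proof -
    have m: "sum f A \<le> sum g B" if "finite B" "A \<subseteq> B" "\<And>x. x \<in> A \<Longrightarrow> f x \<le> g x" "\<And>x. x \<in> B \<Longrightarrow> 0 \<le> g x"
      for A B :: "nat set" and f g :: "nat \<Rightarrow> real"
      using sum_mono[of A f g, OF that(3)] sum_mono2[OF that(1,2), of g] that(4) by force
    show ?thesis using assms by (intro m sum_nonneg) auto
  qed
  hence "?a / (2 * (real (card J'))\<^sup>2 * (real (card J') - 1))
      \<le> ?b / (2 * (real (card J'))\<^sup>2 * (real (card J') - 1))"
    using assms by (intro divide_right_mono) auto
  also have "\<dots> = (real (card J))\<^sup>2 * (real (card J) - 1)
    / ((real (card J'))\<^sup>2 * (real (card J') - 1)) * (?b / (2 * (real (card J))\<^sup>2 * (real (card J) - 1)))"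
  proof -
    have "(real (card J))\<^sup>2 * (real (card J) - 1) \<noteq> 0" using c by simp
    thus ?thesis by (simp add: mult_ac)
  qed
  finally show ?thesis unfolding pair_dev_def pair_sum_def .
qed

lemma sum_antisymmetrize:
  fixes a b :: "nat \<Rightarrow> real"
  assumes "finite R"
  shows "(\<Sum>r\<in>R. \<Sum>s\<in>R. a r * (b s - b r)) = (\<Sum>r\<in>R. \<Sum>s\<in>R - {r}. (a r - a s) * (b s - b r)) / 2"
proof -
  have "(\<Sum>r\<in>R. \<Sum>s\<in>R. a r * (b s - b r)) = (\<Sum>r\<in>R. \<Sum>s\<in>R. a s * (b r - b s))"
    by (rule sum.swap)
  moreover have "(\<Sum>r\<in>R. \<Sum>s\<in>R. a r * (b s - b r)) + (\<Sum>r\<in>R. \<Sum>s\<in>R. a s * (b r - b s))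
      = (\<Sum>r\<in>R. \<Sum>s\<in>R. (a r - a s) * (b s - b r))"
    unfolding sum.distrib[symmetric] by (intro sum.cong refl) (simp add: algebra_simps)
  moreover have "(\<Sum>r\<in>R. \<Sum>s\<in>R. (a r - a s) * (b s - b r)) = (\<Sum>r\<in>R. \<Sum>s\<in>R - {r}. (a r - a s) * (b s - b r))"
    using assms by (intro sum.cong refl sum.mono_neutral_right) auto
  ultimately show ?thesis by simp
qed

text \<open>
The expectation of \<open>S * g S\<close> is given by \<open>diag_exp_size_bias\<close>. To compare the term of the entry \<open>(j, r)\<close>
with \<open>E g (S + 1)\<close>, expand the latter along row \<open>j\<close>. The part of this expansion with \<open>p j s\<close> gives the first
sum, and what is left is the average over \<open>s\<close> of the difference between removing column \<open>s\<close> and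
removing column \<open>r\<close>, which is antisymmetric in \<open>r\<close> and \<open>s\<close>. The matrices without row \<open>j\<close> and column
\<open>s\<close> or \<open>r\<close> are then expanded along the other one of these two columns, and their difference is
governed by \<open>p k r - p k s\<close>.
\<close>

lemma stein_identity:
  assumes J: "finite J" "finite R" "card J = card R"
  defines "m \<equiv> real (card J)"
  shows "diag_exp p J R (\<lambda>x. mat_mean p J R * g (Suc x) - real x * g x) =
    (\<Sum>j\<in>J. \<Sum>r\<in>R. row_avg p R j * p j r * diag_exp p (J - {j}) (R - {r}) (fdiff (fshift g))) / m
    + pair_sum J R (\<lambda>j k r s. (p j r - p j s) * (p k r - p k s) *
        diag_exp p (J - {j, k}) (R - {r, s}) (fdiff (fshift g)))"
proof (cases "J = {}")
  case True
  with J have "R = {}" by auto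
  thus ?thesis using True by (simp add: mat_mean_def pair_sum_def)
next
  case False
  let ?G = "fshift g" and ?D = "fdiff (fshift g)"
  let ?E = "\<lambda>j r. diag_exp p (J - {j}) (R - {r})"
  let ?E2 = "\<lambda>j k r s. diag_exp p (J - {j, k}) (R - {r, s})"
  have m: "m > 0" "real (card R) = m" using J False by (auto simp: m_def card_gt_0_iff)
  have m1: "real (card (J - {j})) = m - 1" if "j \<in> J" for j
    using J that False card_gt_0_iff[of J] by (simp add: m_def of_nat_diff Suc_le_eq)
  have row: "diag_exp p J R ?G - ?E j r ?G = (\<Sum>s\<in>R. p j s * ?E j s ?D + (?E j s ?G - ?E j r ?G)) / m"
    if "j \<in> J" for j r
    unfolding diag_exp_row'[OF J(1,2) that, of p ?G] m_def[symmetric]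
    using m by (simp add: sum.distrib sum_subtractf field_simps)
  have col: "?E j s ?G - ?E j r ?G = (\<Sum>k\<in>J - {j}. (p k r - p k s) * ?E2 j k r s ?D) / (m - 1)"
    if "j \<in> J" "r \<in> R" "s \<in> R - {r}" for j r s
  proof -
    have c: "?E j a ?G = (\<Sum>k\<in>J - {j}. diag_exp p (J - {j, k}) (R - {a, b}) ?G
        + p k b * diag_exp p (J - {j, k}) (R - {a, b}) ?D) / (m - 1)"
      if "a \<in> R" "b \<in> R - {a}" for a b
      using diag_exp_col'[of "J - {j}" "R - {a}" b p ?G] J that \<open>j \<in> J\<close>
      unfolding m1[OF \<open>j \<in> J\<close>] Diff_Diff_singleton by simp
    have "?E j r ?G = (\<Sum>k\<in>J - {j}. ?E2 j k r s ?G + p k s * ?E2 j k r s ?D) / (m - 1)"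
      using that by (intro c) auto
    moreover have "?E j s ?G = (\<Sum>k\<in>J - {j}. ?E2 j k r s ?G + p k r * ?E2 j k r s ?D) / (m - 1)"
      using c[of s r] that unfolding insert_commute[of s r] by auto
    ultimately show ?thesis
      by (simp add: left_diff_distrib sum.distrib sum_subtractf diff_divide_distrib add_divide_distrib)
  qed
  have "diag_exp p J R (\<lambda>x. mat_mean p J R * g (Suc x) - real x * g x) =
     mat_mean p J R * diag_exp p J R ?G - diag_exp p J R (\<lambda>x. real x * g x)"
    by (simp add: diag_exp_diff diag_exp_cmult)
  also have "\<dots> = (\<Sum>j\<in>J. \<Sum>r\<in>R. p j r * (diag_exp p J R ?G - ?E j r ?G)) / m"
    unfolding mat_mean_def diag_exp_size_bias[OF J] m_def[symmetric]
    by (simp add: right_diff_distrib sum_subtractf sum_distrib_right diff_divide_distrib)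
  also have "\<dots> = (\<Sum>j\<in>J. (\<Sum>r\<in>R. row_avg p R j * p j r * ?E j r ?D)
      + (\<Sum>r\<in>R. \<Sum>s\<in>R. p j r * (?E j s ?G - ?E j r ?G)) / m) / m"
  proof (intro arg_cong[of _ _ "\<lambda>x. x / m"] sum.cong refl)
    fix j assume j: "j \<in> J"
    have "(\<Sum>r\<in>R. p j r * (diag_exp p J R ?G - ?E j r ?G)) =
       (\<Sum>r\<in>R. p j r * ((\<Sum>s\<in>R. p j s * ?E j s ?D) / m)) + (\<Sum>r\<in>R. \<Sum>s\<in>R. p j r * (?E j s ?G - ?E j r ?G)) / m"
      unfolding row[OF j]
      by (simp add: sum.distrib add_divide_distrib distrib_left sum_distrib_left sum_divide_distrib)
    also have "(\<Sum>r\<in>R. p j r * ((\<Sum>s\<in>R. p j s * ?E j s ?D) / m)) = (\<Sum>r\<in>R. row_avg p R j * p j r * ?E j r ?D)"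
      unfolding sum_distrib_right[symmetric] row_avg_def m(2) by (simp add: sum_distrib_left mult.assoc flip: sum_divide_distrib)
    finally show "(\<Sum>r\<in>R. p j r * (diag_exp p J R ?G - ?E j r ?G)) =
      (\<Sum>r\<in>R. row_avg p R j * p j r * ?E j r ?D) + (\<Sum>r\<in>R. \<Sum>s\<in>R. p j r * (?E j s ?G - ?E j r ?G)) / m" .
  qed
  also have "\<dots> = (\<Sum>j\<in>J. \<Sum>r\<in>R. row_avg p R j * p j r * ?E j r ?D) / m
      + (\<Sum>j\<in>J. \<Sum>r\<in>R. \<Sum>s\<in>R. p j r * (?E j s ?G - ?E j r ?G)) / m\<^sup>2"
    by (simp add: sum.distrib add_divide_distrib sum_divide_distrib power2_eq_square)
  also have "(\<Sum>j\<in>J. \<Sum>r\<in>R. \<Sum>s\<in>R. p j r * (?E j s ?G - ?E j r ?G)) / m\<^sup>2 =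
      pair_sum J R (\<lambda>j k r s. (p j r - p j s) * (p k r - p k s) * ?E2 j k r s ?D)"
  proof -
    have "(\<Sum>r\<in>R. \<Sum>s\<in>R. p j r * (?E j s ?G - ?E j r ?G)) =
        (\<Sum>k\<in>J - {j}. \<Sum>r\<in>R. \<Sum>s\<in>R - {r}. (p j r - p j s) * (p k r - p k s) * ?E2 j k r s ?D) / (2 * (m - 1))"
      if j: "j \<in> J" for j
    proof -
      let ?t = "\<lambda>k r s. (p j r - p j s) * (p k r - p k s) * ?E2 j k r s ?D"
      have "(\<Sum>r\<in>R. \<Sum>s\<in>R. p j r * (?E j s ?G - ?E j r ?G)) =
          (\<Sum>r\<in>R. \<Sum>s\<in>R - {r}. (p j r - p j s) * (?E j s ?G - ?E j r ?G)) / 2"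
        by (rule sum_antisymmetrize[OF J(2)])
      also have "(\<Sum>r\<in>R. \<Sum>s\<in>R - {r}. (p j r - p j s) * (?E j s ?G - ?E j r ?G)) =
          (\<Sum>r\<in>R. \<Sum>s\<in>R - {r}. \<Sum>k\<in>J - {j}. ?t k r s / (m - 1))"
        by (intro sum.cong refl) (simp add: col[OF j] sum_distrib_left sum_divide_distrib mult.assoc)
      also have "\<dots> = (\<Sum>r\<in>R. \<Sum>k\<in>J - {j}. \<Sum>s\<in>R - {r}. ?t k r s / (m - 1))"
        by (intro sum.cong refl sum.swap)
      also have "\<dots> = (\<Sum>k\<in>J - {j}. \<Sum>r\<in>R. \<Sum>s\<in>R - {r}. ?t k r s / (m - 1))"
        by (rule sum.swap)
      finally show ?thesis by (simp add: sum_divide_distrib right_diff_distrib mult.commute[of m 2])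
    qed
    moreover have "(\<Sum>j\<in>J. F j / (2 * (m - 1))) / m\<^sup>2 = (\<Sum>j\<in>J. F j) / (2 * m\<^sup>2 * (m - 1))" for F
      unfolding sum_divide_distrib[symmetric] divide_divide_eq_left by (simp only: mult_ac)
    ultimately show ?thesis by (simp only: pair_sum_def m_def[symmetric] cong: sum.cong)
  qed
  finally show ?thesis .
qed

lemma stein_operator_bound:
  assumes J: "finite J" "finite R" "card J = card R" "card J \<ge> 2"
    and p: "\<And>j r. j \<in> J \<Longrightarrow> r \<in> R \<Longrightarrow> p j r \<in> {0..1}"
    and g: "\<And>x. \<bar>g (Suc (Suc x)) - g (Suc x)\<bar> \<le> K"
  shows "\<bar>diag_exp p J R (\<lambda>x. mat_mean p J R * g (Suc x) - real x * g x)\<bar>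
    \<le> K * (row_sq p J R + pair_dev p J R)"
proof -
  let ?D = "fdiff (fshift g)"
  have E1: "\<bar>diag_exp p (J - {j}) (R - {r}) ?D\<bar> \<le> K" if "j \<in> J" "r \<in> R" for j r
    using J p that by (intro diag_exp_bound g) auto
  have E2: "\<bar>diag_exp p (J - {j, k}) (R - {r, s}) ?D\<bar> \<le> K"
    if "j \<in> J" "k \<in> J - {j}" "r \<in> R" "s \<in> R - {r}" for j k r s
    using J p that by (intro diag_exp_bound g) (auto simp: card_Diff_subset)
  have av: "row_avg p R j \<ge> 0" if "j \<in> J" for j
    unfolding row_avg_def using p[OF that] by (intro divide_nonneg_nonneg sum_nonneg) auto
  have "\<bar>\<Sum>j\<in>J. \<Sum>r\<in>R. row_avg p R j * p j r * diag_exp p (J - {j}) (R - {r}) ?D\<bar>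
      \<le> (\<Sum>j\<in>J. \<Sum>r\<in>R. row_avg p R j * p j r * K)"
  proof (intro order_trans[OF sum_abs] sum_mono)
    fix j r assume jr: "j \<in> J" "r \<in> R"
    thus "\<bar>row_avg p R j * p j r * diag_exp p (J - {j}) (R - {r}) ?D\<bar> \<le> row_avg p R j * p j r * K"
      using av[of j] p[of j r] E1[of j r] by (simp add: abs_mult mult_left_mono)
  qed
  also have "\<dots> = K * (\<Sum>j\<in>J. \<Sum>r\<in>R. row_avg p R j * p j r)"
    by (simp add: sum_distrib_left mult_ac)
  finally have 1: "\<bar>(\<Sum>j\<in>J. \<Sum>r\<in>R. row_avg p R j * p j r * diag_exp p (J - {j}) (R - {r}) ?D) / real (card J)\<bar>
      \<le> K * row_sq p J R"
    unfolding row_sq_eq[OF J(3)] abs_divide by (simp add: divide_right_mono)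
  have "\<bar>pair_sum J R (\<lambda>j k r s. (p j r - p j s) * (p k r - p k s) * diag_exp p (J - {j, k}) (R - {r, s}) ?D)\<bar>
      \<le> pair_sum J R (\<lambda>j k r s. K * (\<bar>p j r - p j s\<bar> * \<bar>p k r - p k s\<bar>))"
    using J(4)
    by (intro order_trans[OF pair_sum_abs] pair_sum_mono)
       (auto simp: abs_mult mult.commute[of K] intro!: mult_left_mono E2)
  hence 2: "\<bar>pair_sum J R (\<lambda>j k r s. (p j r - p j s) * (p k r - p k s) * diag_exp p (J - {j, k}) (R - {r, s}) ?D)\<bar>
      \<le> K * pair_dev p J R"
    unfolding pair_sum_cmult pair_dev_def .
  show ?thesis unfolding stein_identity[OF J(1-3)] distrib_left
    using 1 2 by linarith
qed

text \<open>
The mean \<open>t\<close> of the Poisson law need not be the mean of the diagonal sum. Comparing with \<open>t\<close> directly,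
rather than through the Poisson law with the correct mean, keeps the Stein factor
\<open>(1 - exp (- t)) / t\<close> in terms of \<open>t\<close> even when the mean of the submatrix is smaller than \<open>t\<close>.
\<close>

lemma diag_exp_poisson_approx:
  assumes J: "finite J" "finite R" "card J = card R" "card J \<ge> 2"
    and p: "\<And>j r. j \<in> J \<Longrightarrow> r \<in> R \<Longrightarrow> p j r \<in> {0..1}"
    and t: "t > 0" and c: "c > 0" and f: "\<And>x. \<bar>f x\<bar> \<le> c"
  shows "\<bar>diag_exp p J R f - pois_exp t f\<bar> \<le> 2 * c *
    (min 1 (sqrt (2 / (t * exp 1))) * \<bar>t - mat_mean p J R\<bar>
      + (1 - exp (- t)) / t * (row_sq p J R + pair_dev p J R))"
proof -
  \<comment> \<open>Rescale \<open>f\<close> to a function with values in \<open>[0,1]\<close>.\<close>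
  define h where "h = (\<lambda>x. 1 / (2 * c) * f x + 1 / 2)"
  have h: "h x \<in> {0..1}" for x
    using f[of x] c by (auto simp: h_def field_simps abs_le_iff)
  let ?g = "stein t h" and ?\<mu> = "mat_mean p J R"
  have "diag_exp p J R h - pois_exp t h = 1 / (2 * c) * (diag_exp p J R f - pois_exp t f)"
    unfolding h_def pois_exp_affine[of f c, OF f] diag_exp_add diag_exp_cmult diag_exp_const[OF J(1-3)]
    by (simp add: right_diff_distrib)
  moreover have "diag_exp p J R h - pois_exp t h = diag_exp p J R (\<lambda>x. h x - pois_exp t h)"
    by (simp add: diag_exp_diff diag_exp_const[OF J(1-3)])
  moreover have "(\<lambda>x. h x - pois_exp t h) = (\<lambda>x. (t - ?\<mu>) * ?g (Suc x) + (?\<mu> * ?g (Suc x) - real x * ?g x))"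
    by (simp add: stein_eq[OF t, symmetric] algebra_simps)
  moreover have "\<bar>diag_exp p J R (\<lambda>x. (t - ?\<mu>) * ?g (Suc x) + (?\<mu> * ?g (Suc x) - real x * ?g x))\<bar>
     \<le> \<bar>t - ?\<mu>\<bar> * min 1 (sqrt (2 / (t * exp 1))) + (1 - exp (- t)) / t * (row_sq p J R + pair_dev p J R)"
    unfolding diag_exp_add diag_exp_cmult
  proof (rule order_trans[OF abs_triangle_ineq add_mono])
    show "\<bar>(t - ?\<mu>) * diag_exp p J R (\<lambda>x. ?g (Suc x))\<bar> \<le> \<bar>t - ?\<mu>\<bar> * min 1 (sqrt (2 / (t * exp 1)))"
      unfolding abs_mult
      by (intro mult_left_mono diag_exp_bound[OF J(1-3) p] stein_bound[of t h, OF t h]) auto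
    show "\<bar>diag_exp p J R (\<lambda>x. ?\<mu> * ?g (Suc x) - real x * ?g x)\<bar>
      \<le> (1 - exp (- t)) / t * (row_sq p J R + pair_dev p J R)"
      by (intro stein_operator_bound J p stein_diff_bound[of t h, OF t h])
  qed
  ultimately have "\<bar>1 / (2 * c) * (diag_exp p J R f - pois_exp t f)\<bar>
     \<le> \<bar>t - ?\<mu>\<bar> * min 1 (sqrt (2 / (t * exp 1))) + (1 - exp (- t)) / t * (row_sq p J R + pair_dev p J R)"
    by (simp only:)
  thus ?thesis using c by (simp add: abs_mult abs_divide pos_divide_le_eq mult_ac)
qed

section \<open>The law of the diagonal sum\<close>

lemma bern_exp_perms:
  "(\<Sum>\<sigma>\<in>perms n. bern_exp {1..n} (\<lambda>j. p j (\<sigma> j)) h) / fact n = diag_exp p {1..n} {1..n} h"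
proof -
  have "(\<Sum>\<sigma>\<in>perms n. bern_exp {1..n} (\<lambda>j. p j (\<sigma> j)) h)
      = (\<Sum>\<sigma>\<in>bijections {1..n} {1..n}. bern_exp {1..n} (\<lambda>j. p j (\<sigma> j)) h)"
  proof (rule sum.reindex_bij_witness[where j = "\<lambda>\<sigma>. restrict \<sigma> {1..n}"
        and i = "\<lambda>\<tau> x. if x \<in> {1..n} then \<tau> x else x"], goal_cases)
    case (1 \<sigma>)
    thus ?case by (auto simp: perms_def fun_eq_iff permutes_def)
  next
    case (2 \<sigma>)
    hence "bij_betw \<sigma> {1..n} {1..n}" by (auto simp: perms_def intro: permutes_imp_bij)
    thus ?case by (auto simp: bijections_def dest: bij_betwE)
  next
    case (3 \<tau>)
    thus ?case by (auto simp: bijections_def fun_eq_iff PiE_def extensional_def)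
  next
    case (4 \<tau>)
    hence "bij_betw \<tau> {1..n} {1..n}" by (auto simp: bijections_def)
    hence "bij_betw (\<lambda>x. if x \<in> {1..n} then \<tau> x else x) {1..n} {1..n}"
      by (rule bij_betw_cong[THEN iffD2, rotated]) auto
    thus ?case by (auto simp: perms_def intro!: bij_imp_permutes)
  next
    case (5 \<sigma>)
    show ?case by (rule bern_exp_cong) auto
  qed
  thus ?thesis by (simp add: diag_exp_def)
qed

lemma measurable_nat_sum:
  fixes f :: "'i \<Rightarrow> 'a \<Rightarrow> nat"
  assumes "\<And>i. i \<in> I \<Longrightarrow> f i \<in> M \<rightarrow>\<^sub>M count_space UNIV"
  shows "(\<lambda>x. \<Sum>i\<in>I. f i x) \<in> M \<rightarrow>\<^sub>M count_space UNIV"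
  using assms
proof (induction I rule: infinite_finite_induct)
  case (insert i I)
  have S: "(\<lambda>x. \<Sum>i\<in>I. f i x) \<in> M \<rightarrow>\<^sub>M count_space UNIV" using insert by auto
  have "(\<lambda>x. f i x + (\<Sum>i\<in>I. f i x)) \<in> M \<rightarrow>\<^sub>M count_space UNIV"
  proof (rule measurable_compose_countable'[where g = "f i" and I = UNIV])
    fix k show "(\<lambda>x. k + (\<Sum>i\<in>I. f i x)) \<in> M \<rightarrow>\<^sub>M count_space UNIV"
      by (rule measurable_compose[OF S]) simp
  qed (use insert in auto)
  thus ?case using insert by simp
qed auto

context bernoulli_matrix_perm
begin

lemma finite_perms: "finite (perms n)"
  by (simp add: perms_def finite_permutations)

lemma perm_mem: "\<omega> \<in> space M \<Longrightarrow> \<pi> \<omega> \<in> perms n"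
  using measurable_space[OF \<pi>_measurable] by simp

lemma perms_in: "\<sigma> \<in> perms n \<Longrightarrow> j \<in> {1..n} \<Longrightarrow> \<sigma> j \<in> {1..n}"
  using permutes_in_image unfolding perms_def by fastforce

lemma diag_sum_measurable: "diag_sum n X \<pi> \<in> M \<rightarrow>\<^sub>M count_space UNIV"
proof -
  have "(\<lambda>\<omega>. (\<lambda>\<sigma> \<omega>. \<Sum>j=1..n. X j (\<sigma> j) \<omega>) (\<pi> \<omega>) \<omega>) \<in> M \<rightarrow>\<^sub>M count_space UNIV"
  proof (rule measurable_compose_countable'[OF _ \<pi>_measurable])
    fix \<sigma> assume \<sigma>: "\<sigma> \<in> perms n"
    show "(\<lambda>\<omega>. \<Sum>j=1..n. X j (\<sigma> j) \<omega>) \<in> M \<rightarrow>\<^sub>M count_space UNIV"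
      by (intro measurable_nat_sum X_measurable perms_in[OF \<sigma>])
  qed (simp add: finite_perms countable_finite)
  thus ?thesis by (simp add: diag_sum_def[abs_def])
qed

lemma prob_X:
  assumes "j \<in> {1..n}" "r \<in> {1..n}"
  shows "prob (X j r -` A \<inter> space M) = measure_pmf.prob (map_pmf of_bool (bernoulli_pmf (p j r))) A"
  unfolding X_bernoulli[OF assms, symmetric]
  by (rule measure_distr[OF X_measurable[OF assms], symmetric]) simp

lemma prob_X_eq:
  assumes "j \<in> {1..n}" "r \<in> {1..n}"
  shows "prob (X j r -` {of_bool b} \<inter> space M) = (if b then p j r else 1 - p j r)"
proof -
  have "(of_bool -` {of_bool b :: nat}) = {b}" by (auto simp: of_bool_def split: if_splits)
  thus ?thesis unfolding prob_X[OF assms] measure_map_pmf using p_range[OF assms]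
    by (simp add: measure_pmf_single)
qed

lemma AE_X_01: "AE \<omega> in M. \<forall>j\<in>{1..n}. \<forall>r\<in>{1..n}. X j r \<omega> \<in> {0, 1}"
proof (intro AE_finite_allI finite_atLeastAtMost)
  fix j r assume jr: "j \<in> {1..n}" "r \<in> {1..n}"
  have "(of_bool -` {0,1::nat}) = UNIV" by (auto simp: of_bool_def)
  hence "prob (X j r -` {0,1} \<inter> space M) = 1" unfolding prob_X[OF jr] measure_map_pmf by simp
  from AE_prob_1[OF this] show "AE \<omega> in M. X j r \<omega> \<in> {0, 1}" by (rule AE_mp) (intro AE_I2, auto)
qed

text \<open>
The event that the random permutation is \<open>\<sigma>\<close> and the variables on its diagonal equal to 1 are exactly
those in the rows \<open>B\<close>. Almost surely exactly one of these events occurs, and the diagonal sum is then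
the cardinality of \<open>B\<close>.
\<close>

definition pattern :: "(nat \<Rightarrow> nat) \<Rightarrow> nat set \<Rightarrow> 'a set" where
  "pattern \<sigma> B = {\<omega> \<in> space M. \<pi> \<omega> = \<sigma> \<and> (\<forall>j\<in>{1..n}. X j (\<sigma> j) \<omega> = of_bool (j \<in> B))}"

lemma prob_pattern:
  assumes \<sigma>: "\<sigma> \<in> perms n" and B: "B \<subseteq> {1..n}"
  shows "pattern \<sigma> B \<in> events"
    and "prob (pattern \<sigma> B) = (\<Prod>j\<in>B. p j (\<sigma> j)) * (\<Prod>j\<in>{1..n} - B. 1 - p j (\<sigma> j)) / fact n"
proof -
  let ?A = "\<lambda>i. case i of None \<Rightarrow> \<pi> -` {\<sigma>} \<inter> space M
    | Some (j, r) \<Rightarrow> X j r -` {of_bool (j \<in> B)} \<inter> space M"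
  let ?I = "insert None ((\<lambda>j. Some (j, \<sigma> j)) ` {1..n})"
  have eq: "pattern \<sigma> B = (\<Inter>i\<in>?I. ?A i)" by (auto simp: pattern_def)
  have ev: "?A i \<in> events" if "i \<in> ?I" for i
    using that
  proof (elim insertE imageE)
    assume i: "i = None"
    show ?thesis unfolding i option.case using \<sigma> by (intro measurable_sets[OF \<pi>_measurable]) simp
  next
    fix j assume i: "i = Some (j, \<sigma> j)" and j: "j \<in> {1..n}"
    show ?thesis unfolding i option.case prod.case
      by (rule measurable_sets[OF X_measurable[OF j perms_in[OF \<sigma> j]]]) simp
  qed
  show "pattern \<sigma> B \<in> events"
    unfolding eq by (rule sets.finite_INT) (simp_all only: finite_insert finite_imageI finite_atLeastAtMost insert_not_empty ev simp_thms)
  have "prob (\<pi> -` {\<sigma>} \<inter> space M) = measure (uniform_count_measure (perms n)) {\<sigma>}"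
    unfolding \<pi>_uniform[symmetric] using \<sigma> by (subst measure_distr[OF \<pi>_measurable]) auto
  also have "\<dots> = 1 / fact n"
    using \<sigma> finite_perms
    by (subst measure_uniform_count_measure) (auto simp: perms_def card_permutations)
  finally have prob_perm: "prob (?A None) = 1 / fact n" by simp
  have indep_prod: "prob (\<Inter>i\<in>?I. ?A i) = (\<Prod>i\<in>?I. prob (?A i))"
  proof (rule indep_setsD[OF indep[unfolded indep_matrix_perm_def]])
    show "?I \<subseteq> insert None (Some ` ({1..n} \<times> {1..n}))" using perms_in[OF \<sigma>] by blast
    show "\<forall>i\<in>?I. ?A i \<in> (case i of None \<Rightarrow> {\<pi> -` B \<inter> space M |B. B \<subseteq> perms n}
        | Some (j, r) \<Rightarrow> {X j r -` B \<inter> space M |B. B \<subseteq> UNIV})"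
    proof
      fix i assume i: "i \<in> ?I"
      show "?A i \<in> (case i of None \<Rightarrow> {\<pi> -` B \<inter> space M |B. B \<subseteq> perms n}
        | Some (j, r) \<Rightarrow> {X j r -` B \<inter> space M |B. B \<subseteq> UNIV})"
      proof (cases i)
        case None
        have "{\<sigma>} \<subseteq> perms n" using \<sigma> by simp
        thus ?thesis unfolding None option.case by (intro CollectI exI[of _ "{\<sigma>}"] conjI refl)
      next
        case (Some x)
        obtain j r where x: "x = (j, r)" by (cases x)
        show ?thesis unfolding Some x option.case prod.case
          by (intro CollectI exI[of _ "{of_bool (j \<in> B)}"] conjI refl subset_UNIV)
      qed
    qed
  qed simp_all
  have image_prod: "(\<Prod>i\<in>(\<lambda>j. Some (j, \<sigma> j)) ` {1..n}. prob (?A i)) = (\<Prod>j=1..n. prob (?A (Some (j, \<sigma> j))))"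
    by (rule prod.reindex[of "\<lambda>j. Some (j, \<sigma> j)" "{1..n}" "\<lambda>i. prob (?A i)", unfolded o_def])
       (simp add: inj_on_def)
  have factor: "(\<Prod>j=1..n. prob (?A (Some (j, \<sigma> j)))) = (\<Prod>j=1..n. if j \<in> B then p j (\<sigma> j) else 1 - p j (\<sigma> j))"
  proof (rule prod.cong[OF refl])
    fix j assume "j \<in> {1..n}"
    from prob_X_eq[OF this perms_in[OF \<sigma> this], of "j \<in> B"]
    show "prob (?A (Some (j, \<sigma> j))) = (if j \<in> B then p j (\<sigma> j) else 1 - p j (\<sigma> j))"
      unfolding option.case prod.case .
  qed
  have split: "(\<Prod>j=1..n. if j \<in> B then p j (\<sigma> j) else 1 - p j (\<sigma> j))
      = (\<Prod>j\<in>B. p j (\<sigma> j)) * (\<Prod>j\<in>{1..n} - B. 1 - p j (\<sigma> j))"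
  proof -
    have "{1..n} \<inter> {j. j \<in> B} = B" "{1..n} \<inter> - {j. j \<in> B} = {1..n} - B" using B by auto
    with prod.If_cases[of "{1..n}" "\<lambda>j. j \<in> B" "\<lambda>j. p j (\<sigma> j)" "\<lambda>j. 1 - p j (\<sigma> j)"]
    show ?thesis by (simp only: finite_atLeastAtMost simp_thms)
  qed
  have "(\<Prod>i\<in>?I. prob (?A i)) = prob (?A None) * (\<Prod>i\<in>(\<lambda>j. Some (j, \<sigma> j)) ` {1..n}. prob (?A i))"
    by (rule prod.insert) auto
  thus "prob (pattern \<sigma> B) = (\<Prod>j\<in>B. p j (\<sigma> j)) * (\<Prod>j\<in>{1..n} - B. 1 - p j (\<sigma> j)) / fact n"
    unfolding eq indep_prod image_prod factor split prob_perm by (simp only: times_divide_eq_left mult_1_left)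
qed

lemma expectation_fn_diag_sum:
  fixes h :: "nat \<Rightarrow> real"
  shows "expectation (\<lambda>\<omega>. h (diag_sum n X \<pi> \<omega>)) = diag_exp p {1..n} {1..n} h"
proof -
  let ?g = "\<lambda>\<omega>. \<Sum>\<sigma>\<in>perms n. \<Sum>B\<in>Pow {1..n}. h (card B) * indicator (pattern \<sigma> B) \<omega>"
  have int: "integrable M (\<lambda>\<omega>. h (card B) * indicator (pattern \<sigma> B) \<omega>)"
    if "\<sigma> \<in> perms n" "B \<in> Pow {1..n}" for \<sigma> B
    using prob_pattern(1)[of \<sigma> B] that
    by (intro integrable_mult_right integrable_real_indicator) (auto simp: emeasure_eq_measure)
  have ae: "AE \<omega> in M. h (diag_sum n X \<pi> \<omega>) = ?g \<omega>"
  proof (rule AE_mp[OF AE_X_01 AE_I2], intro impI)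
    fix \<omega> assume \<omega>: "\<omega> \<in> space M" and 01: "\<forall>j\<in>{1..n}. \<forall>r\<in>{1..n}. X j r \<omega> \<in> {0, 1}"
    define B where "B = {j \<in> {1..n}. X j (\<pi> \<omega> j) \<omega> = 1}"
    have X: "X j (\<pi> \<omega> j) \<omega> = of_bool (j \<in> B)" if "j \<in> {1..n}" for j
      using bspec[OF bspec[OF 01 that] perms_in[OF perm_mem[OF \<omega>] that]] that by (auto simp: B_def)
    have BJ: "B \<in> Pow {1..n}" by (auto simp: B_def)
    have card: "diag_sum n X \<pi> \<omega> = card B"
      unfolding diag_sum_def using BJ by (simp add: X Int_absorb1 of_bool_def sum.If_cases)
    have ind: "indicator (pattern \<sigma> B') \<omega> = (if \<sigma> = \<pi> \<omega> \<and> B' = B then 1 else 0 :: real)"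
      if "B' \<in> Pow {1..n}" for \<sigma> B'
    proof -
      have "\<omega> \<in> pattern (\<pi> \<omega>) B' \<longleftrightarrow> B' = B"
      proof -
        have "\<omega> \<in> pattern (\<pi> \<omega>) B' \<longleftrightarrow> (\<forall>j\<in>{1..n}. (of_bool (j \<in> B) :: nat) = of_bool (j \<in> B'))"
          using \<omega> X by (simp add: pattern_def)
        also have "\<dots> \<longleftrightarrow> (\<forall>j\<in>{1..n}. j \<in> B \<longleftrightarrow> j \<in> B')" by (simp only: of_bool_eq_iff)
        also have "\<dots> \<longleftrightarrow> B' = B" using that BJ by blast
        finally show ?thesis .
      qed
      moreover have "\<omega> \<notin> pattern \<sigma> B'" if "\<sigma> \<noteq> \<pi> \<omega>" using that by (auto simp: pattern_def)
      ultimately show ?thesis by (cases "\<sigma> = \<pi> \<omega>") (simp_all add: indicator_def)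
    qed
    have "?g \<omega> = (\<Sum>\<sigma>\<in>perms n. \<Sum>B'\<in>Pow {1..n}. if \<sigma> = \<pi> \<omega> then (if B' = B then h (card B') else 0) else 0)"
      by (intro sum.cong refl) (simp add: ind)
    also have "\<dots> = (\<Sum>\<sigma>\<in>perms n. if \<sigma> = \<pi> \<omega> then h (card B) else 0)"
      using BJ by (intro sum.cong refl) auto
    also have "\<dots> = h (card B)" using finite_perms perm_mem[OF \<omega>] by simp
    finally show "h (diag_sum n X \<pi> \<omega>) = ?g \<omega>" using card by simp
  qed
  have "expectation (\<lambda>\<omega>. h (diag_sum n X \<pi> \<omega>)) = expectation ?g"
  proof (rule integral_cong_AE[OF _ _ ae])
    show "(\<lambda>\<omega>. h (diag_sum n X \<pi> \<omega>)) \<in> borel_measurable M"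
      by (rule measurable_compose[OF diag_sum_measurable]) simp
    show "?g \<in> borel_measurable M"
      by (intro borel_measurable_sum borel_measurable_integrable int)
  qed
  also have "\<dots> = (\<Sum>\<sigma>\<in>perms n. \<Sum>B\<in>Pow {1..n}. h (card B) * prob (pattern \<sigma> B))"
  proof -
    have "expectation ?g = (\<Sum>\<sigma>\<in>perms n. \<Sum>B\<in>Pow {1..n}. expectation (\<lambda>\<omega>. h (card B) * indicator (pattern \<sigma> B) \<omega>))"
      by (subst Bochner_Integration.integral_sum, intro Bochner_Integration.integrable_sum int, assumption+)
         (intro sum.cong refl Bochner_Integration.integral_sum int)
    also have "\<dots> = (\<Sum>\<sigma>\<in>perms n. \<Sum>B\<in>Pow {1..n}. h (card B) * prob (pattern \<sigma> B))"
    proof (intro sum.cong refl)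
      fix \<sigma> B assume "\<sigma> \<in> perms n" "B \<in> Pow {1..n}"
      hence "pattern \<sigma> B \<in> events" by (intro prob_pattern(1)) auto
      thus "expectation (\<lambda>\<omega>. h (card B) * indicator (pattern \<sigma> B) \<omega>) = h (card B) * prob (pattern \<sigma> B)"
        by simp
    qed
    finally show ?thesis .
  qed
  also have "\<dots> = (\<Sum>\<sigma>\<in>perms n. bern_exp {1..n} (\<lambda>j. p j (\<sigma> j)) h / fact n)"
    unfolding bern_exp_def sum_divide_distrib
    by (intro sum.cong refl) (simp add: prob_pattern(2))
  also have "\<dots> = diag_exp p {1..n} {1..n} h"
    unfolding bern_exp_perms[symmetric] sum_divide_distrib ..
  finally show ?thesis .
qed

lemma distr_diag_sum:
  "measure (distr M (count_space UNIV) (diag_sum n X \<pi>)) A = diag_exp p {1..n} {1..n} (indicator A)"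
proof -
  have "measure (distr M (count_space UNIV) (diag_sum n X \<pi>)) A = prob (diag_sum n X \<pi> -` A \<inter> space M)"
    by (rule measure_distr[OF diag_sum_measurable]) simp
  also have "\<dots> = expectation (indicator (diag_sum n X \<pi> -` A))"
    using measurable_sets[OF diag_sum_measurable, of A] by (simp add: Int_commute)
  also have "indicator (diag_sum n X \<pi> -` A) = (\<lambda>\<omega>. indicator A (diag_sum n X \<pi> \<omega>) :: real)"
    by (rule ext) (simp add: indicator_def)
  finally show ?thesis using expectation_fn_diag_sum[of "indicator A"] by simp
qed

end

section \<open>Comparison with the signed measure\<close>

lemma Po_eq_pois_exp:
  assumes "t > 0"
  shows "Po t A = pois_exp t (indicator A)"
proof -
  have P: "Po t {k} = pois t k" for k
    using assms by (simp add: Po_def measure_pmf_single pois_def)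
  have "((\<lambda>k. pois t k * indicator A k) has_sum Po t A) UNIV"
    using Po_has_sum[of t A]
    by (subst has_sum_cong_neutral[where T = A and g = "\<lambda>k. Po t {k}"]) (auto simp: P indicator_def)
  hence "(\<lambda>k. pois t k * indicator A k) sums Po t A" by (rule has_sum_imp_sums)
  thus ?thesis by (simp add: pois_exp_def sums_iff)
qed

text \<open>
Evaluate the Stein equation at \<open>Z + i\<close>, with \<open>Z\<close> Poisson with mean \<open>t\<close>, and take expectations. Since
\<open>E (Z * g (Z + i)) = t * E g (Z + i + 1)\<close>, only \<open>- i * E g (Z + i)\<close> remains on the left side.
\<close>

lemma Po_stein_shift:
  fixes A :: "nat set"
  assumes t: "t > 0"
  defines "h \<equiv> indicator A :: nat \<Rightarrow> real"
  shows "real i * pois_exp t (\<lambda>k. stein t h (k + i)) = Po t A - Po t {l. l + i \<in> A}"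
proof -
  let ?g = "stein t h"
  have h: "h k \<in> {0..1}" for k by (simp add: h_def indicator_def)
  have g1: "\<bar>?g x\<bar> \<le> 1" for x
    using stein_bound[of t h, OF t h] by (cases x) auto
  define D where "D = t + (1 + \<bar>pois_exp t h\<bar>)"
  have xg: "\<bar>real x * ?g x\<bar> \<le> D" for x
  proof -
    have "real x * ?g x = t * ?g (Suc x) - (h x - pois_exp t h)" using stein_eq[OF t, of h x] by simp
    moreover have "\<bar>t * ?g (Suc x)\<bar> \<le> t * 1" using t g1[of "Suc x"] by (simp add: abs_mult)
    ultimately show ?thesis using h[of x] by (auto simp: D_def)
  qed
  have g: "\<bar>?g (k + i)\<bar> \<le> 1" for k by (rule g1)
  have kg: "\<bar>real k * ?g (k + i)\<bar> \<le> D" for k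
    using xg[of "k + i"] by (intro order_trans[OF _ xg[of "k + i"]]) (simp add: abs_mult mult_right_mono)
  have hb: "\<bar>h (k + i)\<bar> \<le> 1" for k using h[of "k + i"] by auto
  have sum: "\<bar>real k * ?g (k + i) + real i * ?g (k + i)\<bar> \<le> D" for k
    using xg[of "k + i"] by (simp add: algebra_simps)
  have ig: "\<bar>real i * ?g (k + i)\<bar> \<le> real i" for k
    using g1[of "k + i"] by (simp add: abs_mult mult_left_le)
  have tg: "\<bar>t * ?g (Suc k + i)\<bar> \<le> t" for k
    using g1[of "Suc k + i"] t by (simp add: abs_mult)
  have sg: "\<bar>?g (Suc k + i)\<bar> \<le> 1" for k by (rule g1)
  have "pois_exp t (\<lambda>k. h (k + i)) - pois_exp t h = pois_exp t (\<lambda>k. 1 * h (k + i) + - pois_exp t h)"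
    by (subst pois_exp_affine[of "\<lambda>k. h (k + i)" 1, OF hb]) simp
  also have "(\<lambda>k. 1 * h (k + i) + - pois_exp t h) =
      (\<lambda>k. t * ?g (Suc k + i) - (real k * ?g (k + i) + real i * ?g (k + i)))"
    using stein_eq[OF t, of h "_ + i"] by (intro ext) (simp add: algebra_simps)
  also have "pois_exp t \<dots> = pois_exp t (\<lambda>k. t * ?g (Suc k + i))
      - (pois_exp t (\<lambda>k. real k * ?g (k + i)) + pois_exp t (\<lambda>k. real i * ?g (k + i)))"
    unfolding pois_exp_diff[of "\<lambda>k. t * ?g (Suc k + i)" t, OF tg sum]
      pois_exp_add[of "\<lambda>k. real k * ?g (k + i)" D, OF kg ig] ..
  also have "pois_exp t (\<lambda>k. t * ?g (Suc k + i)) = t * pois_exp t (\<lambda>k. ?g (Suc k + i))"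
    using pois_exp_affine[of "\<lambda>k. ?g (Suc k + i)" 1 t t 0, OF sg] by simp
  also have "pois_exp t (\<lambda>k. real k * ?g (k + i)) = t * pois_exp t (\<lambda>k. ?g (Suc k + i))"
    by (rule pois_exp_size_bias[of "\<lambda>k. ?g (k + i)" 1 D, OF g kg])
  also have "pois_exp t (\<lambda>k. real i * ?g (k + i)) = real i * pois_exp t (\<lambda>k. ?g (k + i))"
    using pois_exp_affine[of "\<lambda>k. ?g (k + i)" 1 t "real i" 0, OF g] by simp
  finally have "real i * pois_exp t (\<lambda>k. ?g (k + i)) = pois_exp t h - pois_exp t (\<lambda>k. h (k + i))"
    by simp
  moreover have "(\<lambda>k. h (k + i)) = indicator {l. l + i \<in> A}" by (rule ext) (simp add: h_def indicator_def)
  ultimately show ?thesis by (simp add: Po_eq_pois_exp[OF t] h_def)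
qed

text \<open>
The cases \<open>i = 2\<close> and \<open>i = 1\<close> of the preceding lemma express the expectation of the increment of the
Stein solution by the second difference of the Poisson law.
\<close>

lemma Q2_eq_stein:
  assumes t: "t > 0"
  shows "Q2 t v A = Po t A + (t - v) * pois_exp t (fdiff (fshift (stein t (indicator A))))"
proof -
  let ?g = "stein t (indicator A)"
  have h: "indicator A k \<in> {0..1::real}" for k by (simp add: indicator_def)
  have g: "\<bar>?g (k + i)\<bar> \<le> 1" if "i > 0" for k i
    using stein_bound[of t "indicator A" "k + i - 1", OF t h] that by simp
  have "pois_exp t (\<lambda>k. ?g (k + 2) - ?g (k + 1)) = pois_exp t (\<lambda>k. ?g (k + 2)) - pois_exp t (\<lambda>k. ?g (k + 1))"
    by (rule pois_exp_diff) (rule g, simp)+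
  also have "\<dots> = (Po t A - Po t {l. l + 2 \<in> A}) / 2 - (Po t A - Po t {l. l + 1 \<in> A})"
    using Po_stein_shift[OF t, of 2 A] Po_stein_shift[OF t, of 1 A] by simp
  also have "\<dots> = - (1 / 2) * (Po t A - 2 * Po t {l. l + 1 \<in> A} + Po t {l. l + 2 \<in> A})"
  proof -
    have "(a - b) / 2 - (a - c) = - (1 / 2) * (a - 2 * c + b)" for a b c :: real
      by (simp add: field_simps)
    thus ?thesis by blast
  qed
  finally have "pois_exp t (\<lambda>k. ?g (k + 2) - ?g (k + 1)) =
      - (1 / 2) * (Po t A - 2 * Po t {l. l + 1 \<in> A} + Po t {l. l + 2 \<in> A})" .
  moreover have "(\<lambda>k. ?g (k + 2) - ?g (k + 1)) = fdiff (fshift ?g)" by simp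
  ultimately have e: "pois_exp t (fdiff (fshift ?g)) =
      - (1 / 2) * (Po t A - 2 * Po t {l. l + 1 \<in> A} + Po t {l. l + 2 \<in> A})"
    by (simp only:)
  show ?thesis unfolding Q2_def conv_dirac_Po e by simp
qed

lemma pair_sum_offdiag:
  assumes "n \<ge> 1"
  shows "pair_sum {1..n} {1..n} F =
    (\<Sum>(j, k)\<in>offdiag n. \<Sum>(r, s)\<in>offdiag n. F j k r s) / (2 * (real n)\<^sup>2 * (real n - 1))"
proof -
  have o: "offdiag n = Sigma {1..n} (\<lambda>j. {1..n} - {j})" by (auto simp: offdiag_def)
  show ?thesis unfolding pair_sum_def o by (simp add: sum.Sigma[symmetric])
qed

text \<open>
Here \<open>a\<close> and \<open>c\<close> stand for \<open>row_sq\<close> and \<open>pair_dev\<close> of the full \<open>N \<times> N\<close> matrix, and the factors after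
\<open>a\<close> and \<open>c\<close> on the left bound the same quantities after the removal of one, respectively two, rows
and columns. The square on the right agrees with the left side in the terms with \<open>a\<^sup>2\<close> and \<open>c\<^sup>2\<close>, and
dominates it in the mixed term.
\<close>

lemma combine_submatrix_bounds:
  fixes N a c :: real
  assumes N: "N \<ge> 4" and "a \<ge> 0" "c \<ge> 0"
  shows "a * ((N / (N - 1))\<^sup>2 * a + N\<^sup>2 * (N - 1) / ((N - 1)\<^sup>2 * (N - 2)) * c)
      + c * ((N / (N - 2))\<^sup>2 * a + N\<^sup>2 * (N - 1) / ((N - 2)\<^sup>2 * (N - 3)) * c)
    \<le> N\<^sup>2 / (N - 2)\<^sup>2 * ((N - 2) / (N - 1) * a + sqrt ((N - 1) / (N - 3)) * c)\<^sup>2"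
proof -
  define s where "s = sqrt ((N - 1) / (N - 3))"
  have s2: "s\<^sup>2 = (N - 1) / (N - 3)" using N by (simp add: s_def)
  \<comment> \<open>In terms of \<open>x = N - 4\<close> the polynomial inequality below holds coefficient by coefficient.\<close>
  define x where "x = N - 4"
  have x: "x \<ge> 0" "N = x + 4" using N by (auto simp: x_def)
  have s: "1 + (N - 1) / (N - 2) \<le> 2 * s"
  proof -
    have "((2 * N - 3) / (2 * (N - 2)))\<^sup>2 \<le> (N - 1) / (N - 3)"
    proof -
      have "(2 * N - 3)\<^sup>2 * (N - 3) \<le> (N - 1) * (2 * (N - 2))\<^sup>2"
        unfolding x using x(1) by (simp add: power2_eq_square algebra_simps)
      thus ?thesis using N by (simp add: power_divide frac_le_eq divide_le_eq pos_le_divide_eq)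
    qed
    hence "(2 * N - 3) / (2 * (N - 2)) \<le> s" unfolding s_def by (rule real_le_rsqrt)
    thus ?thesis using N by (simp add: field_simps)
  qed
  have "a * ((N / (N - 1))\<^sup>2 * a + N\<^sup>2 * (N - 1) / ((N - 1)\<^sup>2 * (N - 2)) * c)
      + c * ((N / (N - 2))\<^sup>2 * a + N\<^sup>2 * (N - 1) / ((N - 2)\<^sup>2 * (N - 3)) * c)
    = (N / (N - 1))\<^sup>2 * a\<^sup>2 + N\<^sup>2 / ((N - 1) * (N - 2)) * (a * c) * (1 + (N - 1) / (N - 2))
      + N\<^sup>2 / (N - 2)\<^sup>2 * s\<^sup>2 * c\<^sup>2"
  proof -
    have 1: "N\<^sup>2 * (N - 1) / ((N - 1)\<^sup>2 * (N - 2)) = N\<^sup>2 / ((N - 1) * (N - 2))"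
      using N by (simp add: power2_eq_square)
    have 2: "(N / (N - 2))\<^sup>2 = N\<^sup>2 / ((N - 1) * (N - 2)) * ((N - 1) / (N - 2))"
      using N by (simp add: power2_eq_square)
    have 3: "N\<^sup>2 * (N - 1) / ((N - 2)\<^sup>2 * (N - 3)) = N\<^sup>2 / (N - 2)\<^sup>2 * s\<^sup>2"
      unfolding s2 by simp
    have "a * (x * a + y * c) + c * (y * q * a + w * c) = x * a\<^sup>2 + y * (a * c) * (1 + q) + w * c\<^sup>2"
      for x y q w :: real by (simp add: power2_eq_square algebra_simps)
    thus ?thesis unfolding 1 2 3 by blast
  qed
  also have "\<dots> \<le> (N / (N - 1))\<^sup>2 * a\<^sup>2 + N\<^sup>2 / ((N - 1) * (N - 2)) * (a * c) * (2 * s)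
      + N\<^sup>2 / (N - 2)\<^sup>2 * s\<^sup>2 * c\<^sup>2"
    using N assms s by (intro add_mono mult_left_mono order_refl) auto
  also have "\<dots> = N\<^sup>2 / (N - 2)\<^sup>2 * ((N - 2) / (N - 1) * a + s * c)\<^sup>2"
  proof -
    define A where "A = N / (N - 1)"
    define B where "B = N / (N - 2)"
    have 1: "N\<^sup>2 / ((N - 1) * (N - 2)) = A * B" by (simp add: A_def B_def power2_eq_square)
    have 2: "N\<^sup>2 / (N - 2)\<^sup>2 = B\<^sup>2" by (simp add: B_def power_divide)
    have 3: "B * ((N - 2) / (N - 1)) = A" using N by (simp add: A_def B_def)
    have "A\<^sup>2 * a\<^sup>2 + A * B * (a * c) * (2 * s) + B\<^sup>2 * s\<^sup>2 * c\<^sup>2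
        = (B * ((N - 2) / (N - 1)) * a + B * (s * c))\<^sup>2"
      unfolding 3 by (simp add: power2_eq_square algebra_simps)
    also have "\<dots> = B\<^sup>2 * ((N - 2) / (N - 1) * a + s * c)\<^sup>2"
      unfolding power_mult_distrib[symmetric] by (simp only: distrib_left mult.assoc)
    finally show ?thesis unfolding 1 2 A_def[symmetric] .
  qed
  finally show ?thesis by (simp add: s_def)
qed

lemma diag_exp_Q2_bound:
  assumes n: "n \<ge> 4" and p: "\<And>j r. j \<in> {1..n} \<Longrightarrow> r \<in> {1..n} \<Longrightarrow> p j r \<in> {0..1}" and L: "lam n p > 0"
  defines "I \<equiv> {1..n}"
  defines "b \<equiv> pair_sum I I (\<lambda>j k r s. (p j r - p j s) * (p k r - p k s))"
  shows "\<bar>diag_exp p I I (indicator A) - Q2 (lam n p) (lam n p - (row_sq p I I + b)) A\<bar>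
    \<le> (1 - exp (- lam n p)) / lam n p * eps n p"
proof -
  let ?L = "lam n p" and ?N = "real n"
  define h where "h = (indicator A :: nat \<Rightarrow> real)"
  define f where "f = fdiff (fshift (stein ?L h))"
  define \<kappa> where "\<kappa> = (1 - exp (- ?L)) / ?L"
  define m where "m = min 1 (sqrt (2 / (?L * exp 1)))"
  define \<alpha> where "\<alpha> = row_sq p I I"
  define \<gamma> where "\<gamma> = pair_dev p I I"
  define e where "e = pois_exp ?L f"
  let ?E1 = "\<lambda>j r. diag_exp p (I - {j}) (I - {r}) f"
  let ?E2 = "\<lambda>j k r s. diag_exp p (I - {j, k}) (I - {r, s}) f"
  have n1: "n \<ge> 1" using n by simp
  have I: "finite I" "card I = n" by (auto simp: I_def)
  have c1: "card (I - {j}) = n - 1" if "j \<in> I" for j using that I by simp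
  have c2: "card (I - {j, k}) = n - 2" if "j \<in> I" "k \<in> I - {j}" for j k
    using that I by (subst card_Diff_subset) auto
  have pI: "p j r \<in> {0..1}" if "j \<in> I" "r \<in> I" for j r using p that by (simp add: I_def)
  have mean: "mat_mean p I I = ?L" by (simp add: mat_mean_def lam_def I_def)
  have mean1: "mat_mean p (I - {j}) (I - {r}) = lam1 n p j r" if "j \<in> I" for j r
    unfolding mat_mean_def lam1_def c1[OF that] using n by (simp add: I_def)
  have mean2: "mat_mean p (I - {j, k}) (I - {r, s}) = lam2 n p j k r s" if "j \<in> I" "k \<in> I - {j}" for j k r s
    unfolding mat_mean_def lam2_def c2[OF that] using n by (simp add: I_def)
  have ravg: "row_avg p I j = row_mean n p j" for j by (simp add: row_avg_def row_mean_def I_def)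
  have ravg0: "row_avg p I j \<ge> 0" if "j \<in> I" for j
    unfolding row_avg_def using pI[OF that] by (intro divide_nonneg_nonneg sum_nonneg) auto
  have h: "h k \<in> {0..1}" for k by (simp add: h_def indicator_def)
  have \<kappa>: "\<kappa> > 0" using L by (simp add: \<kappa>_def)
  have m0: "m \<ge> 0" using L by (simp add: m_def)
  have fb: "\<bar>f x\<bar> \<le> \<kappa>" for x
    unfolding f_def \<kappa>_def by (rule stein_diff_bound[of ?L h, OF L h])
  have \<alpha>0: "\<alpha> \<ge> 0" and \<gamma>0: "\<gamma> \<ge> 0" by (simp_all add: \<alpha>_def \<gamma>_def row_sq_nonneg pair_dev_nonneg)
  define B1 where "B1 = (?N / (?N - 1))\<^sup>2 * \<alpha> + ?N\<^sup>2 * (?N - 1) / ((?N - 1)\<^sup>2 * (?N - 2)) * \<gamma>"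
  define B2 where "B2 = (?N / (?N - 2))\<^sup>2 * \<alpha> + ?N\<^sup>2 * (?N - 1) / ((?N - 2)\<^sup>2 * (?N - 3)) * \<gamma>"
  have E1: "\<bar>?E1 j r - e\<bar> \<le> 2 * \<kappa> * (m * \<bar>?L - lam1 n p j r\<bar> + \<kappa> * B1)" if jr: "j \<in> I" "r \<in> I" for j r
  proof -
    have "\<bar>?E1 j r - e\<bar> \<le> 2 * \<kappa> * (m * \<bar>?L - lam1 n p j r\<bar>
        + \<kappa> * (row_sq p (I - {j}) (I - {r}) + pair_dev p (I - {j}) (I - {r})))"
      unfolding e_def mean1[OF jr(1), of r, symmetric] m_def \<kappa>_def
      by (intro diag_exp_poisson_approx L \<kappa>[unfolded \<kappa>_def] fb[unfolded \<kappa>_def] pI)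
         (use I c1 jr n in auto)
    also have "row_sq p (I - {j}) (I - {r}) \<le> (?N / (?N - 1))\<^sup>2 * \<alpha>"
      using row_sq_submatrix[of I "I - {j}" I "I - {r}" p] I c1[OF jr(2)] pI n
      by (simp add: \<alpha>_def of_nat_diff)
    also have "pair_dev p (I - {j}) (I - {r}) \<le> ?N\<^sup>2 * (?N - 1) / ((?N - 1)\<^sup>2 * (?N - 2)) * \<gamma>"
      using pair_dev_submatrix[of I "I - {j}" I "I - {r}" p] I c1[OF jr(1)] n
      by (simp add: \<gamma>_def of_nat_diff)
    finally show ?thesis using \<kappa> by (simp add: B1_def)
  qed
  have E2: "\<bar>?E2 j k r s - e\<bar> \<le> 2 * \<kappa> * (m * \<bar>?L - lam2 n p j k r s\<bar> + \<kappa> * B2)"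
    if jk: "j \<in> I" "k \<in> I - {j}" and rs: "r \<in> I" "s \<in> I - {r}" for j k r s
  proof -
    have "\<bar>?E2 j k r s - e\<bar> \<le> 2 * \<kappa> * (m * \<bar>?L - lam2 n p j k r s\<bar>
        + \<kappa> * (row_sq p (I - {j, k}) (I - {r, s}) + pair_dev p (I - {j, k}) (I - {r, s})))"
      unfolding e_def mean2[OF jk, of r s, symmetric] m_def \<kappa>_def
      by (intro diag_exp_poisson_approx L \<kappa>[unfolded \<kappa>_def] fb[unfolded \<kappa>_def] pI)
         (use I c2[OF jk] c2[OF rs] n in auto)
    also have "row_sq p (I - {j, k}) (I - {r, s}) \<le> (?N / (?N - 2))\<^sup>2 * \<alpha>"
      using row_sq_submatrix[of I "I - {j, k}" I "I - {r, s}" p] I c2[OF rs] pI n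
      by (simp add: \<alpha>_def of_nat_diff)
    also have "pair_dev p (I - {j, k}) (I - {r, s}) \<le> ?N\<^sup>2 * (?N - 1) / ((?N - 2)\<^sup>2 * (?N - 3)) * \<gamma>"
      using pair_dev_submatrix[of I "I - {j, k}" I "I - {r, s}" p] I c2[OF jk] n
      by (simp add: \<gamma>_def of_nat_diff)
    finally show ?thesis using \<kappa> by (simp add: B2_def)
  qed
  let ?T1 = "(\<Sum>j\<in>I. \<Sum>r\<in>I. row_avg p I j * p j r * (?E1 j r - e)) / ?N"
  let ?T2 = "pair_sum I I (\<lambda>j k r s. (p j r - p j s) * (p k r - p k s) * (?E2 j k r s - e))"
  have "diag_exp p I I h - Po ?L A = diag_exp p I I (\<lambda>x. h x - pois_exp ?L h)"
    using I by (simp add: diag_exp_diff diag_exp_const Po_eq_pois_exp[OF L] h_def)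
  also have "\<dots> = diag_exp p I I (\<lambda>x. mat_mean p I I * stein ?L h (Suc x) - real x * stein ?L h x)"
    by (simp add: stein_eq[OF L, symmetric] mean)
  also have "\<dots> = (\<Sum>j\<in>I. \<Sum>r\<in>I. row_avg p I j * p j r * ?E1 j r) / ?N
      + pair_sum I I (\<lambda>j k r s. (p j r - p j s) * (p k r - p k s) * ?E2 j k r s)"
    using stein_identity[of I I p "stein ?L h"] I by (simp add: f_def)
  also have "\<dots> = ?T1 + ?T2 + (\<alpha> + b) * e"
  proof -
    have "(\<Sum>j\<in>I. \<Sum>r\<in>I. row_avg p I j * p j r * ?E1 j r) / ?N = ?T1 + \<alpha> * e"
      unfolding \<alpha>_def row_sq_eq[OF refl] I(2)
      by (simp add: right_diff_distrib sum_subtractf diff_divide_distrib sum_distrib_right)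
    moreover have "pair_sum I I (\<lambda>j k r s. (p j r - p j s) * (p k r - p k s) * ?E2 j k r s) = ?T2 + e * b"
      unfolding b_def pair_sum_cmult[symmetric] pair_sum_add[symmetric]
      by (rule pair_sum_cong) (simp add: algebra_simps)
    ultimately show ?thesis by (simp add: algebra_simps)
  qed
  finally have diff: "diag_exp p I I h - Q2 ?L (?L - (\<alpha> + b)) A = ?T1 + ?T2"
    unfolding Q2_eq_stein[OF L] by (simp add: e_def f_def h_def)
  have T1: "\<bar>?T1\<bar> \<le> \<kappa> * (m * eps1 n p) + 2 * \<kappa>\<^sup>2 * (\<alpha> * B1)"
  proof -
    have "\<bar>\<Sum>j\<in>I. \<Sum>r\<in>I. row_avg p I j * p j r * (?E1 j r - e)\<bar>
       \<le> (\<Sum>j\<in>I. \<Sum>r\<in>I. row_avg p I j * p j r * (2 * \<kappa> * (m * \<bar>?L - lam1 n p j r\<bar> + \<kappa> * B1)))"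
    proof (intro order_trans[OF sum_abs] sum_mono)
      fix j r assume jr: "j \<in> I" "r \<in> I"
      thus "\<bar>row_avg p I j * p j r * (?E1 j r - e)\<bar>
        \<le> row_avg p I j * p j r * (2 * \<kappa> * (m * \<bar>?L - lam1 n p j r\<bar> + \<kappa> * B1))"
        using ravg0[of j] pI[OF jr] E1[OF jr] by (simp add: abs_mult mult_left_mono)
    qed
    hence "\<bar>?T1\<bar> \<le> (\<Sum>j\<in>I. \<Sum>r\<in>I. row_avg p I j * p j r * (2 * \<kappa> * (m * \<bar>?L - lam1 n p j r\<bar> + \<kappa> * B1))) / ?N"
      unfolding abs_divide by (simp add: divide_right_mono)
    also have "\<dots> = \<kappa> * m * (2 / ?N * (\<Sum>j\<in>I. \<Sum>r\<in>I. row_avg p I j * p j r * \<bar>?L - lam1 n p j r\<bar>))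
       + 2 * \<kappa>\<^sup>2 * B1 * ((\<Sum>j\<in>I. \<Sum>r\<in>I. row_avg p I j * p j r) / ?N)"
      by (simp add: sum_distrib_left sum_divide_distrib sum.distrib[symmetric])
         (simp add: algebra_simps power2_eq_square add_divide_distrib)
    also have "\<dots> = \<kappa> * (m * eps1 n p) + 2 * \<kappa>\<^sup>2 * (\<alpha> * B1)"
      unfolding eps1_def \<alpha>_def row_sq_eq[OF refl] I(2) ravg by (simp add: I_def mult_ac)
    finally show ?thesis .
  qed
  have T2: "\<bar>?T2\<bar> \<le> \<kappa> * (m * eps2 n p) + 2 * \<kappa>\<^sup>2 * (\<gamma> * B2)"
  proof -
    let ?d = "\<lambda>j k r s. \<bar>p j r - p j s\<bar> * \<bar>p k r - p k s\<bar>"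
    have "\<bar>?T2\<bar> \<le> pair_sum I I (\<lambda>j k r s. 2 * \<kappa> * m * (?d j k r s * \<bar>?L - lam2 n p j k r s\<bar>) + 2 * \<kappa>\<^sup>2 * B2 * ?d j k r s)"
    proof (rule order_trans[OF pair_sum_abs pair_sum_mono])
      fix j k r s assume "j \<in> I" "k \<in> I - {j}" "r \<in> I" "s \<in> I - {r}"
      note bd = E2[OF this]
      have "\<bar>(p j r - p j s) * (p k r - p k s) * (?E2 j k r s - e)\<bar> = ?d j k r s * \<bar>?E2 j k r s - e\<bar>"
        by (simp only: abs_mult)
      also have "\<dots> \<le> ?d j k r s * (2 * \<kappa> * (m * \<bar>?L - lam2 n p j k r s\<bar> + \<kappa> * B2))"
        by (rule mult_left_mono[OF bd]) simp
      also have "\<dots> = 2 * \<kappa> * m * (?d j k r s * \<bar>?L - lam2 n p j k r s\<bar>) + 2 * \<kappa>\<^sup>2 * B2 * ?d j k r s"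
        by (simp only: power2_eq_square distrib_left mult_ac)
      finally show "\<bar>(p j r - p j s) * (p k r - p k s) * (?E2 j k r s - e)\<bar>
        \<le> 2 * \<kappa> * m * (?d j k r s * \<bar>?L - lam2 n p j k r s\<bar>) + 2 * \<kappa>\<^sup>2 * B2 * ?d j k r s" .
    qed (use I n in auto)
    also have "\<dots> = 2 * \<kappa> * m * pair_sum I I (\<lambda>j k r s. ?d j k r s * \<bar>?L - lam2 n p j k r s\<bar>) + 2 * \<kappa>\<^sup>2 * B2 * \<gamma>"
      unfolding pair_sum_add pair_sum_cmult \<gamma>_def pair_dev_def ..
    also have "2 * \<kappa> * m * pair_sum I I (\<lambda>j k r s. ?d j k r s * \<bar>?L - lam2 n p j k r s\<bar>) = \<kappa> * (m * eps2 n p)"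
      unfolding I_def pair_sum_offdiag[OF n1] eps2_def by simp
    finally show ?thesis by (simp only: mult.assoc mult.commute[of B2 \<gamma>])
  qed
  have \<gamma>: "gam2 n p = \<gamma>"
    unfolding \<gamma>_def pair_dev_def I_def pair_sum_offdiag[OF n1] gam2_def by simp
  have "\<alpha> * B1 + \<gamma> * B2 \<le> ?N\<^sup>2 / (?N - 2)\<^sup>2 * ((?N - 2) / (?N - 1) * \<alpha> + sqrt ((?N - 1) / (?N - 3)) * \<gamma>)\<^sup>2"
    unfolding B1_def B2_def using n by (intro combine_submatrix_bounds \<alpha>0 \<gamma>0) auto
  hence "2 * \<kappa>\<^sup>2 * (\<alpha> * B1 + \<gamma> * B2) \<le> 2 * \<kappa>\<^sup>2 * (?N\<^sup>2 / (?N - 2)\<^sup>2 * ((?N - 2) / (?N - 1) * \<alpha> + sqrt ((?N - 1) / (?N - 3)) * \<gamma>)\<^sup>2)"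
    by (intro mult_left_mono) auto
  also have "\<dots> = \<kappa>\<^sup>2 * eps3 n p"
    unfolding eps3_def \<gamma> \<alpha>_def row_sq_def ravg by (simp add: I_def)
  finally have "\<bar>?T1 + ?T2\<bar> \<le> \<kappa> * (m * (eps1 n p + eps2 n p)) + \<kappa>\<^sup>2 * eps3 n p"
    using T1 T2 abs_triangle_ineq[of ?T1 ?T2] by (simp add: algebra_simps)
  also have "\<dots> = \<kappa> * eps n p"
    by (simp add: eps_def m_def \<kappa>_def[symmetric] algebra_simps power2_eq_square)
  finally show ?thesis using diff by (simp add: \<alpha>_def h_def \<kappa>_def)
qed

text \<open>
The Stein identity for \<open>g\<close> the identity function, in which all increments are 1.
\<close>

lemma (in bernoulli_matrix_perm) variance_diag_sum:
  assumes n: "n \<ge> 1"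
  defines "I \<equiv> {1..n}"
  shows "variance (\<lambda>\<omega>. real (diag_sum n X \<pi> \<omega>)) = lam n p -
    (row_sq p I I + pair_sum I I (\<lambda>j k r s. (p j r - p j s) * (p k r - p k s)))"
proof -
  let ?L = "lam n p"
  have I: "finite I" "card I = n" by (auto simp: I_def)
  have mean: "diag_exp p I I real = ?L"
    using expectation_fn_diag_sum[of real] expectation_diag_sum by (simp add: I_def)
  have mm: "mat_mean p I I = ?L" by (simp add: mat_mean_def lam_def I_def)
  have one: "diag_exp p (I - {j}) (I - {r}) (\<lambda>_. 1) = 1" if "j \<in> I" "r \<in> I" for j r
    using that I by (intro diag_exp_const) auto
  have two: "diag_exp p (I - {j, k}) (I - {r, s}) (\<lambda>_. 1) = 1"
    if "j \<in> I" "k \<in> I - {j}" "r \<in> I" "s \<in> I - {r}" for j k r s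
    using that I by (intro diag_exp_const) (auto simp: card_Diff_subset)
  have "variance (\<lambda>\<omega>. real (diag_sum n X \<pi> \<omega>)) = diag_exp p I I (\<lambda>x. (real x - ?L)\<^sup>2)"
    using expectation_fn_diag_sum[of "\<lambda>x. (real x - ?L)\<^sup>2"] by (simp add: expectation_diag_sum I_def)
  also have "(\<lambda>x. (real x - ?L)\<^sup>2) =
      (\<lambda>x. ?L\<^sup>2 + ?L - ?L * real x - (mat_mean p I I * real (Suc x) - real x * real x))"
    by (rule ext) (simp add: mm power2_eq_square algebra_simps)
  also have "diag_exp p I I \<dots> = ?L - diag_exp p I I (\<lambda>x. mat_mean p I I * real (Suc x) - real x * real x)"
    unfolding diag_exp_diff diag_exp_cmult mean using I
    by (subst diag_exp_const) (auto simp: power2_eq_square)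
  also have "diag_exp p I I (\<lambda>x. mat_mean p I I * real (Suc x) - real x * real x) =
      row_sq p I I + pair_sum I I (\<lambda>j k r s. (p j r - p j s) * (p k r - p k s))"
  proof -
    have "pair_sum I I (\<lambda>j k r s. (p j r - p j s) * (p k r - p k s) * diag_exp p (I - {j, k}) (I - {r, s}) (\<lambda>_. 1))
        = pair_sum I I (\<lambda>j k r s. (p j r - p j s) * (p k r - p k s))"
      by (rule pair_sum_cong) (simp add: two)
    moreover have "(\<Sum>j\<in>I. \<Sum>r\<in>I. row_avg p I j * p j r * diag_exp p (I - {j}) (I - {r}) (\<lambda>_. 1)) / real (card I)
       = row_sq p I I"
      unfolding row_sq_eq[OF refl] by (simp add: one)
    ultimately show ?thesis
      using stein_identity[of I I p real] I by simp
  qed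
  finally show ?thesis .
qed

theorem theorem2p2:
  fixes M :: "'a measure"
    and n :: nat
    and p :: "nat \<Rightarrow> nat \<Rightarrow> real"
    and X :: "nat \<Rightarrow> nat \<Rightarrow> 'a \<Rightarrow> nat"
    and \<pi> :: "'a \<Rightarrow> nat \<Rightarrow> nat"
  assumes "n \<ge> 4"
    and "bernoulli_matrix_perm M n p X \<pi>"
    and "lam n p > 0"
  shows "dTV (measure (distr M (count_space UNIV) (diag_sum n X \<pi>)))
             (Q2 (lam n p) (prob_space.variance M (\<lambda>\<omega>. real (diag_sum n X \<pi> \<omega>))))
         \<le> (1 - exp (- lam n p)) / lam n p * eps n p"
proof -
  interpret bernoulli_matrix_perm M n p X \<pi> by fact
  have n: "n \<ge> 1" using assms(1) by simp
  show ?thesis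
    unfolding dTV_def distr_diag_sum variance_diag_sum[OF n]
    by (rule cSUP_least) (use diag_exp_Q2_bound[OF assms(1) p_range assms(3)] in auto)
qed

end
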